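(* Let $\lambda$ be a partition and $n\ge 2$. If $T\in\mathrm{SVT}^n(\lambda)$ is a Yamanouchi set-valued tableau of weight $\mu$, then the closure $\mathrm{SVT}^n(T)$ of $\{T\}$ under all $e_i,f_i$ ($1\le i<n$) is isomorphic as a crystal to $B(\mu)$. Moreover, \[\mathrm{SVT}^n(\lambda)\cong\bigoplus_{\mu}B(\mu)^{\oplus M_\lambda^\mu},\] where $M_\lambda^\mu$ is the number of Yamanouchi set-valued tableaux in $\mathrm{SVT}^n(\lambda)$ of weight $\mu$.
   Context: A semistandard set-valued tableau of shape $\lambda$ (English convention) is a filling of the boxes by nonempty finite sets of positive integers such that every choice of one integer per box gives a semistandard tableau (rows weakly increasing, columns strictly increasing); $\mathrm{SVT}^n(\lambda)$ is the set of those with entries at most $n$, and $\mathrm{SSYT}^n(\lambda)$ the subset with all sets singletons. Crystal operators, $1\le i<n$: write $+$ above each column containing (in some box) $i$ but not $i+1$, $-$ above each column containing $i+1$ but not $i$; reading columns left to right, repeatedly delete adjacent pairs $-+$. If no $+$ remains, $f_iT=0$; otherwise let $\mathsf b$ be the box containing $i$ in the column of the rightmost remaining $+$ and $\mathsf b^{\rightarrow}$ the box immediately right; if $i\notin\mathsf b^{\rightarrow}$, $f_iT$ replaces $i$ by $i+1$ in $\mathsf b$, otherwise removes $i$ from $\mathsf b^{\rightarrow}$ and adds $i+1$ to $\mathsf b$. If no $-$ remains, $e_iT=0$; otherwise let $\mathsf b$ be the box containing $i+1$ in the column of the leftmost remaining $-$ and $\mathsf b^{\leftarrow}$ the box immediately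 left; if $i+1\notin\mathsf b^{\leftarrow}$, $e_iT$ replaces $i+1$ by $i$ in $\mathsf b$, otherwise removes $i+1$ from $\mathsf b^{\leftarrow}$ and adds $i$ to $\mathsf b$. Weight: $\mathrm{wt}(T)=(c_1,\dots,c_n)$, $c_j$ = number of boxes containing $j$ (for a Yamanouchi tableau this is a partition). A Yamanouchi set-valued tableau is one with $e_iT=0$ for all $1\le i<n$ (a highest weight element). $B(\mu)$ is $\mathrm{SSYT}^n(\mu)$ with the restricted operators (the crystal of the irreducible highest weight $U_q(\mathfrak{sl}_n)$-module of highest weight $\mu$). Crystal isomorphism: weight-preserving bijection commuting with all $e_i,f_i$; the direct sum is disjoint union. *)

theory Defs
  imports Main
begin

section \<open>Partitions and tableaux\<close>

text \<open>Trailing zeros are allowed in a partition and do not change its diagram. Thus a weight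
  $(c_1,\dots,c_n)$ can itself be used as a shape, and every partition with at most $n$ parts is
  represented by exactly one list of length $n$.\<close>

definition is_partition :: "nat list \<Rightarrow> bool" where
  "is_partition lam \<longleftrightarrow> sorted_wrt (\<ge>) lam"

text \<open>Boxes are pairs (row, column), both counted from 0, rows from the top and columns from the
  left (English convention).\<close>

type_synonym box = "nat \<times> nat"

definition diagram :: "nat list \<Rightarrow> box set" where
  "diagram lam = {(r, c). r < length lam \<and> c < lam ! r}"

definition num_columns :: "nat list \<Rightarrow> nat" where
  "num_columns lam = (if lam = [] then 0 else hd lam)"

definition semistandard :: "nat list \<Rightarrow> (box \<Rightarrow> nat) \<Rightarrow> bool" where
  "semistandard lam S \<longleftrightarrow>
     (\<forall>r c c'. (r, c) \<in> diagram lam \<and> (r, c') \<in> diagram lam \<and> c < c' \<longrightarrow> S (r, c) \<le> S (r, c')) \<and>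
     (\<forall>r r' c. (r, c) \<in> diagram lam \<and> (r', c) \<in> diagram lam \<and> r < r' \<longrightarrow> S (r, c) < S (r', c))"

text \<open>A set-valued filling is extended by the empty set outside the diagram, so that equality of
  fillings of a given shape is equality of functions.\<close>

type_synonym filling = "box \<Rightarrow> nat set"

definition SVT :: "nat \<Rightarrow> nat list \<Rightarrow> filling set" where
  "SVT n lam = {T.
     (\<forall>b \<in> diagram lam. T b \<noteq> {} \<and> T b \<subseteq> {1..n}) \<and>
     (\<forall>b. b \<notin> diagram lam \<longrightarrow> T b = {}) \<and>
     (\<forall>S. (\<forall>b \<in> diagram lam. S b \<in> T b) \<longrightarrow> semistandard lam S)}"

definition SSYT :: "nat \<Rightarrow> nat list \<Rightarrow> filling set" where
  "SSYT n lam = {T \<in> SVT n lam. \<forall>b \<in> diagram lam. is_singleton (T b)}"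

definition weight :: "nat \<Rightarrow> filling \<Rightarrow> nat list" where
  "weight n T = map (\<lambda>j. card {b. j \<in> T b}) [1..<n+1]"


section \<open>Signatures\<close>

datatype sign = Plus | Minus

definition in_column :: "nat \<Rightarrow> nat \<Rightarrow> filling \<Rightarrow> bool" where
  "in_column j c T \<longleftrightarrow> (\<exists>r. j \<in> T (r, c))"

definition column_sign :: "nat \<Rightarrow> filling \<Rightarrow> nat \<Rightarrow> (nat \<times> sign) list" where
  "column_sign i T c =
     (if in_column i c T \<and> \<not> in_column (i+1) c T then [(c, Plus)]
      else if in_column (i+1) c T \<and> \<not> in_column i c T then [(c, Minus)]
      else [])"

definition signature :: "nat list \<Rightarrow> nat \<Rightarrow> filling \<Rightarrow> (nat \<times> sign) list" where
  "signature lam i T = concat (map (column_sign i T) [0..<num_columns lam])"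

inductive cancel_step :: "(nat \<times> sign) list \<Rightarrow> (nat \<times> sign) list \<Rightarrow> bool" where
  "cancel_step (u @ [(c, Minus), (d, Plus)] @ v) (u @ v)"

text \<open>The result of repeatedly deleting adjacent pairs $-+$, computed from right to left; by
  \<open>reduced_iff\<close> below it is the unique normal form of \<^const>\<open>cancel_step\<close>, so the order of the
  deletions is irrelevant.\<close>

fun reduced :: "(nat \<times> sign) list \<Rightarrow> (nat \<times> sign) list" where
  "reduced [] = []"
| "reduced (x # w) =
     (case reduced w of
        [] \<Rightarrow> [x]
      | y # v \<Rightarrow> if snd x = Minus \<and> snd y = Plus then v else x # y # v)"

lemma cancel_step_Cons: "cancel_step w v \<Longrightarrow> cancel_step (x # w) (x # v)"
  by (metis append_Cons cancel_step.simps)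

lemma cancel_steps_Cons: "cancel_step\<^sup>*\<^sup>* w v \<Longrightarrow> cancel_step\<^sup>*\<^sup>* (x # w) (x # v)"
  by (induction rule: rtranclp_induct) (auto intro: cancel_step_Cons rtranclp.rtrancl_into_rtrancl)

lemma cancel_steps_reduced: "cancel_step\<^sup>*\<^sup>* w (reduced w)"
proof (induction w)
  case (Cons x w)
  have 1: "cancel_step\<^sup>*\<^sup>* (x # w) (x # reduced w)"
    by (rule cancel_steps_Cons[OF Cons.IH])
  show ?case
  proof (cases "\<exists>y v. reduced w = y # v \<and> snd x = Minus \<and> snd y = Plus")
    case True
    then obtain y v where y: "reduced w = y # v" "snd x = Minus" "snd y = Plus" by blast
    have "cancel_step ([] @ [(fst x, Minus), (fst y, Plus)] @ v) ([] @ v)"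
      by (rule cancel_step.intros)
    then have "cancel_step (x # reduced w) v"
      using y by (cases x, cases y) auto
    then show ?thesis using 1 y by auto
  next
    case False
    then have "reduced (x # w) = x # reduced w" by (auto split: list.split)
    then show ?thesis using 1 by simp
  qed
qed simp

lemma cancel_step_Cons_iff:
  "cancel_step (x # w) z \<longleftrightarrow>
     (\<exists>y v. w = y # v \<and> snd x = Minus \<and> snd y = Plus \<and> z = v) \<or> (\<exists>w'. cancel_step w w' \<and> z = x # w')"
proof
  assume "cancel_step (x # w) z"
  then obtain u c d v where e: "x # w = u @ [(c, Minus), (d, Plus)] @ v" "z = u @ v"
    by (auto elim: cancel_step.cases)
  show "(\<exists>y v. w = y # v \<and> snd x = Minus \<and> snd y = Plus \<and> z = v) \<or> (\<exists>w'. cancel_step w w' \<and> z = x # w')"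
  proof (cases u)
    case Nil
    then show ?thesis using e by auto
  next
    case (Cons a u')
    then have "cancel_step w (u' @ v)" "z = x # (u' @ v)"
      using e cancel_step.intros[of u' c d v] by auto
    then show ?thesis by blast
  qed
next
  assume "(\<exists>y v. w = y # v \<and> snd x = Minus \<and> snd y = Plus \<and> z = v) \<or> (\<exists>w'. cancel_step w w' \<and> z = x # w')"
  then show "cancel_step (x # w) z"
  proof
    assume "\<exists>y v. w = y # v \<and> snd x = Minus \<and> snd y = Plus \<and> z = v"
    then show ?thesis using cancel_step.intros[of "[]" "fst x" _ z]
      by (cases x) (metis append_Cons append_Nil fst_conv snd_conv surj_pair)
  qed (auto intro: cancel_step_Cons)
qed

lemma reduced_irreducible: "\<not> cancel_step (reduced w) z"
proof (induction w arbitrary: z)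
  case Nil
  then show ?case by (auto elim: cancel_step.cases)
next
  case step: (Cons x w)
  have nil: "\<not> cancel_step [] z" for z by (auto elim: cancel_step.cases)
  show ?case
  proof (cases "reduced w")
    case Nil
    then show ?thesis using nil by (simp add: cancel_step_Cons_iff)
  next
    case (Cons y v)
    have irr: "\<not> cancel_step (y # v) z" for z using step.IH Cons by simp
    then have "\<not> cancel_step v z" for z by (blast dest: cancel_step_Cons)
    moreover have "\<not> cancel_step (x # y # v) z" if "\<not> (snd x = Minus \<and> snd y = Plus)" for z
      using that irr by (subst cancel_step_Cons_iff) blast
    ultimately show ?thesis using Cons by simp
  qed
qed

lemma reduced_eq_if_irreducible: "(\<forall>z. \<not> cancel_step w z) \<Longrightarrow> reduced w = w"
proof (induction w)
  case (Cons x w)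
  have "\<forall>z. \<not> cancel_step w z" using Cons.prems by (blast dest: cancel_step_Cons)
  then have "reduced w = w" by (rule Cons.IH)
  moreover have "\<not> (snd x = Minus \<and> snd y = Plus)" if "w = y # v" for y v
    using Cons.prems that by (subst (asm) cancel_step_Cons_iff) blast
  ultimately show ?case by (auto split: list.split)
qed simp

lemma reduced_shape:
  "\<exists>p m. reduced w = p @ m \<and> (\<forall>x \<in> set p. snd x = Plus) \<and> (\<forall>x \<in> set m. snd x = Minus)"
proof (induction w)
  case (Cons x w)
  then obtain p m where pm: "reduced w = p @ m" "\<forall>x \<in> set p. snd x = Plus"
    "\<forall>x \<in> set m. snd x = Minus" by blast
  show ?case
  proof (cases "snd x")
    case Plus
    then have "reduced (x # w) = (x # p) @ m" using pm by (auto split: list.split)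
    then show ?thesis using pm Plus by (metis set_ConsD)
  next
    case Minus
    show ?thesis
    proof (cases p)
      case Nil
      then have "reduced (x # w) = [] @ (x # m)" using pm Minus by (auto split: list.split)
      moreover have "\<forall>y \<in> set (x # m). snd y = Minus" using pm Minus by auto
      ultimately show ?thesis by fastforce
    next
      case (Cons y p')
      then have "reduced (x # w) = p' @ m" using pm Minus by auto
      moreover have "\<forall>y \<in> set p'. snd y = Plus" using pm Cons by auto
      ultimately show ?thesis using pm by blast
    qed
  qed
qed auto

lemma reduced_step: "cancel_step w v \<Longrightarrow> reduced w = reduced v"
proof (induction rule: cancel_step.induct)
  case (1 u c d v)
  have "reduced ((c, Minus) # (d, Plus) # v) = reduced v"
    using reduced_shape[of v] by (auto split: list.split)
  then show ?case by (induction u) auto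
qed

lemma reduced_iff: "cancel_step\<^sup>*\<^sup>* w v \<and> (\<forall>z. \<not> cancel_step v z) \<longleftrightarrow> v = reduced w"
proof
  assume a: "cancel_step\<^sup>*\<^sup>* w v \<and> (\<forall>z. \<not> cancel_step v z)"
  then have "cancel_step\<^sup>*\<^sup>* w v" ..
  then have "reduced w = reduced v" by (induction rule: rtranclp_induct) (auto dest: reduced_step)
  then show "v = reduced w" using a reduced_eq_if_irreducible by metis
qed (use cancel_steps_reduced reduced_irreducible in blast)


section \<open>Crystal operators on set-valued tableaux\<close>

text \<open>The value \<^const>\<open>None\<close> stands for $0$. Columns of a set-valued tableau are strictly increasing,
  hence the box containing a given entry in a given column is unique.\<close>

definition row_of :: "nat \<Rightarrow> nat \<Rightarrow> filling \<Rightarrow> nat" where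
  "row_of j c T = (THE r. j \<in> T (r, c))"

definition svt_f :: "nat list \<Rightarrow> nat \<Rightarrow> filling \<Rightarrow> filling option" where
  "svt_f lam i T =
     (let ps = filter (\<lambda>x. snd x = Plus) (reduced (signature lam i T)) in
      if ps = [] then None
      else
        (let c = fst (last ps); r = row_of i c T; b = (r, c); b' = (r, c + 1) in
         Some (if i \<notin> T b' then T(b := insert (i+1) (T b - {i}))
               else T(b' := T b' - {i}, b := insert (i+1) (T b)))))"

definition svt_e :: "nat list \<Rightarrow> nat \<Rightarrow> filling \<Rightarrow> filling option" where
  "svt_e lam i T =
     (let ms = filter (\<lambda>x. snd x = Minus) (reduced (signature lam i T)) in
      if ms = [] then None
      else
        (let c = fst (hd ms); r = row_of (i+1) c T; b = (r, c); b' = (r, c - 1) in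
         Some (if c = 0 \<or> i+1 \<notin> T b' then T(b := insert i (T b - {i+1}))
               else T(b' := T b' - {i+1}, b := insert i (T b)))))"


section \<open>Crystals\<close>

text \<open>The index set of the operators is $\{1,\dots,n-1\}$ throughout.\<close>

record 'a crystal =
  crystal_set :: "'a set"
  crystal_wt :: "'a \<Rightarrow> nat list"
  crystal_e :: "nat \<Rightarrow> 'a \<Rightarrow> 'a option"
  crystal_f :: "nat \<Rightarrow> 'a \<Rightarrow> 'a option"

definition operators_closed :: "nat \<Rightarrow> 'a crystal \<Rightarrow> bool" where
  "operators_closed n C \<longleftrightarrow>
     (\<forall>i \<in> {1..<n}. \<forall>x \<in> crystal_set C.
        set_option (crystal_e C i x) \<subseteq> crystal_set C \<and>
        set_option (crystal_f C i x) \<subseteq> crystal_set C)"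

definition crystal_iso :: "nat \<Rightarrow> 'a crystal \<Rightarrow> 'b crystal \<Rightarrow> ('a \<Rightarrow> 'b) \<Rightarrow> bool" where
  "crystal_iso n A B h \<longleftrightarrow>
     bij_betw h (crystal_set A) (crystal_set B) \<and>
     (\<forall>x \<in> crystal_set A.
        crystal_wt B (h x) = crystal_wt A x \<and>
        (\<forall>i \<in> {1..<n}.
           crystal_e B i (h x) = map_option h (crystal_e A i x) \<and>
           crystal_f B i (h x) = map_option h (crystal_f A i x)))"

text \<open>Closedness is demanded of both sides because the operators are total functions on the type
  \<open>'a\<close>: without it the commutation conditions could refer to values of \<open>h\<close> outside the crystal.\<close>

definition crystal_isomorphic :: "nat \<Rightarrow> 'a crystal \<Rightarrow> 'b crystal \<Rightarrow> bool" where
  "crystal_isomorphic n A B \<longleftrightarrow>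
     operators_closed n A \<and> operators_closed n B \<and> (\<exists>h. crystal_iso n A B h)"

inductive_set crystal_closure :: "nat \<Rightarrow> 'a crystal \<Rightarrow> 'a \<Rightarrow> 'a set"
  for n :: nat and C :: "'a crystal" and x0 :: 'a where
  base: "x0 \<in> crystal_closure n C x0"
| e_closed: "\<lbrakk>x \<in> crystal_closure n C x0; i \<in> {1..<n}; crystal_e C i x = Some y\<rbrakk>
    \<Longrightarrow> y \<in> crystal_closure n C x0"
| f_closed: "\<lbrakk>x \<in> crystal_closure n C x0; i \<in> {1..<n}; crystal_f C i x = Some y\<rbrakk>
    \<Longrightarrow> y \<in> crystal_closure n C x0"

definition generated_crystal :: "nat \<Rightarrow> 'a crystal \<Rightarrow> 'a \<Rightarrow> 'a crystal" where
  "generated_crystal n C x = C\<lparr>crystal_set := crystal_closure n C x\<rparr>"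

definition direct_sum :: "'k set \<Rightarrow> ('k \<Rightarrow> 'a crystal) \<Rightarrow> ('k \<times> 'a) crystal" where
  "direct_sum K C =
     \<lparr>crystal_set = (SIGMA k:K. crystal_set (C k)),
      crystal_wt = (\<lambda>(k, x). crystal_wt (C k) x),
      crystal_e = (\<lambda>i (k, x). map_option (Pair k) (crystal_e (C k) i x)),
      crystal_f = (\<lambda>i (k, x). map_option (Pair k) (crystal_f (C k) i x))\<rparr>"

definition SVT_crystal :: "nat \<Rightarrow> nat list \<Rightarrow> filling crystal" where
  "SVT_crystal n lam =
     \<lparr>crystal_set = SVT n lam, crystal_wt = weight n, crystal_e = svt_e lam, crystal_f = svt_f lam\<rparr>"

definition B_crystal :: "nat \<Rightarrow> nat list \<Rightarrow> filling crystal" where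
  "B_crystal n mu = (SVT_crystal n mu)\<lparr>crystal_set := SSYT n mu\<rparr>"

definition yamanouchi :: "nat \<Rightarrow> nat list \<Rightarrow> filling set" where
  "yamanouchi n lam = {T \<in> SVT n lam. \<forall>i \<in> {1..<n}. svt_e lam i T = None}"

definition yamanouchi_mult :: "nat \<Rightarrow> nat list \<Rightarrow> nat list \<Rightarrow> nat" where
  "yamanouchi_mult n lam mu = card {T \<in> yamanouchi n lam. weight n T = mu}"

text \<open>This set is finite, so the cardinality above is the true one.\<close>

lemma finite_SVT: "finite (SVT n lam)"
proof -
  have "diagram lam = (SIGMA r:{..<length lam}. {..<lam ! r})" by (auto simp: diagram_def)
  then have "finite (diagram lam)" by simp
  then have "finite {T. \<forall>b. (b \<in> diagram lam \<longrightarrow> T b \<in> Pow {1..n}) \<and> (b \<notin> diagram lam \<longrightarrow> T b = {})}"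
    by (intro finite_set_of_finite_funs) auto
  then show ?thesis by (rule rev_finite_subset) (auto simp: SVT_def)
qed

end

theory Submission
  imports Defs
begin

text \<open>Read the rows of a set-valued tableau from bottom to top, in each row first the elements that
  are not the minimum of their box, in decreasing order, and then the minima from left to right.
  The operators on tableaux turn into the usual signature operators on words: the prefix sums of
  $\#i - \#(i+1)$ over the columns of the tableau and over this word reach their maxima at the same
  places. The word together with the number of non-minimal elements in each row, which the operators
  do not change, determines the tableau.

  On words, a Knuth move at a fixed position is an involution that commutes with all operators. Knuth
  moves transform every Yamanouchi word of weight $\mu$ into $n^{\mu_n} \cdots 2^{\mu_2} 1^{\mu_1}$,
  the reading word of the only Yamanouchi tableau in $\mathrm{SSYT}^n(\mu)$. Hence the component of
  a Yamanouchi tableau of weight $\mu$ is isomorphic to $B(\mu)$ and contains no other Yamanouchi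
  tableau.\<close>

section \<open>Crystals of words and Knuth moves\<close>

text \<open>The columns and the word visit the entries in different orders, so their prefix sums of
  \<open>i\<close> against \<open>Suc i\<close> differ in general. They agree at one place per row:
  if \<open>q\<close> is the last column in which row \<open>r\<close> contains \<open>i\<close>,
  the columns up to \<open>q\<close> hold every \<open>i\<close> of row \<open>r\<close> and of the
  rows below, no \<open>i\<close> of the rows above, and as many \<open>Suc i\<close> as the word
  has read by the last \<open>i\<close> of row \<open>r\<close>. A positive maximum of either path
  is attained at such a place.

  Only \<open>f_i\<close> is followed through the word. That \<open>f_i\<close> undoes
  \<open>e_i\<close> is computed on tableaux; that \<open>e_i\<close> undoes \<open>f_i\<close> is
  pulled back from words, since the word and the numbers of extras determine the tableau.

  Knuth moves are indexed by a position and total on words, so a chain of moves between two words is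
  at once a bijection of all words that commutes with the operators. Rewriting Yamanouchi words to a
  normal form takes the place of the Robinson-Schensted correspondence. The normal form grows by one
  letter at a time, which works because every letter from 1 to \<open>k\<close> commutes with the
  column word k ... 1 up to Knuth moves.\<close>

text \<open>\<open>wphi i w\<close> counts the signs $+$ of \<open>w\<close> that are left after all pairs $-+$ are deleted.\<close>

fun wphi :: "nat \<Rightarrow> nat list \<Rightarrow> nat" where
  "wphi i [] = 0"
| "wphi i (x # w) =
     (if x = i then Suc (wphi i w) else if x = Suc i then wphi i w - 1 else wphi i w)"

text \<open>The changed letter is the rightmost surviving \<open>i\<close>, so a leading
  \<open>i\<close> is changed only if no + of the tail survives. A leading \<open>Suc i\<close>
  cancels the first surviving + of the tail; if there is at most one, none is left, hence the bound
  1.\<close>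

fun word_f :: "nat \<Rightarrow> nat list \<Rightarrow> nat list option" where
  "word_f i [] = None"
| "word_f i (x # w) =
     (if x = i \<and> wphi i w = 0 then Some (Suc i # w)
      else if x = Suc i \<and> wphi i w \<le> 1 then None
      else map_option ((#) x) (word_f i w))"

text \<open>A leading \<open>i\<close> cancels nothing, and a leading \<open>Suc i\<close> is either
  cancelled or itself the leftmost surviving -. In all other cases the tail alone decides.\<close>

fun word_e :: "nat \<Rightarrow> nat list \<Rightarrow> nat list option" where
  "word_e i [] = None"
| "word_e i (x # w) =
     (if x = Suc i \<and> wphi i w = 0 then Some (i # w) else map_option ((#) x) (word_e i w))"

lemma word_f_None_iff: "word_f i w = None \<longleftrightarrow> wphi i w = 0"
  by (induction w) auto

lemma wphi_word_f: "word_f i w = Some v \<Longrightarrow> wphi i w = Suc (wphi i v)"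
proof (induction w arbitrary: v)
  case (Cons x w)
  show ?case
  proof (cases "word_f i w")
    case None
    then show ?thesis using Cons.prems word_f_None_iff[of i w] by (auto split: if_splits)
  next
    case (Some u)
    then show ?thesis using Cons.prems Cons.IH[OF Some] by (auto split: if_splits)
  qed
qed simp

lemma wphi_word_e: "word_e i w = Some v \<Longrightarrow> wphi i v = Suc (wphi i w)"
proof (induction w arbitrary: v)
  case (Cons x w)
  show ?case
  proof (cases "word_e i w")
    case None
    then show ?thesis using Cons.prems by (auto split: if_splits)
  next
    case (Some u)
    then show ?thesis using Cons.prems Cons.IH[OF Some] by (auto split: if_splits)
  qed
qed simp

lemma word_e_iff_f: "word_e i w = Some v \<longleftrightarrow> word_f i v = Some w"
proof
  show "word_e i w = Some v \<Longrightarrow> word_f i v = Some w"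
  proof (induction w arbitrary: v)
    case (Cons x w)
    show ?case
    proof (cases "word_e i w")
      case None
      then show ?thesis using Cons.prems by (auto split: if_splits)
    next
      case (Some u)
      then show ?thesis using Cons.prems Cons.IH[OF Some] wphi_word_e[OF Some]
        by (auto split: if_splits)
    qed
  qed simp
  show "word_f i v = Some w \<Longrightarrow> word_e i w = Some v"
  proof (induction v arbitrary: w)
    case (Cons x v)
    show ?case
    proof (cases "word_f i v")
      case None
      then show ?thesis using Cons.prems by (auto split: if_splits)
    next
      case (Some u)
      then show ?thesis using Cons.prems Cons.IH[OF Some] wphi_word_f[OF Some]
        by (auto split: if_splits)
    qed
  qed simp
qed

text \<open>The elementary Knuth move at position \<open>p\<close>, in whichever direction is applicable.\<close>

fun theta :: "nat \<Rightarrow> nat list \<Rightarrow> nat list" where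
  "theta 0 (a # b # c # w) =
     (if c < a \<and> a \<le> b \<or> b < a \<and> a \<le> c then a # c # b # w
      else if a \<le> c \<and> c < b \<or> b \<le> c \<and> c < a then b # a # c # w
      else a # b # c # w)"
| "theta (Suc p) (a # w) = a # theta p w"
| "theta p w = w"

text \<open>Each of the two clauses is symmetric in the pair that it swaps, and their conditions
  exclude each other, so the second move uses the same clause as the first.\<close>

lemma theta_theta [simp]: "theta p (theta p w) = w"
  by (induction p w rule: theta.induct) auto

lemma count_list_theta [simp]: "count_list (theta p w) j = count_list w j"
  by (induction p w rule: theta.induct) auto

lemma wphi_theta [simp]: "wphi i (theta p w) = wphi i w"
  by (induction p w rule: theta.induct) auto

text \<open>An operator may turn a swap of the first two letters into a swap of the last two: for
  \<open>i = 1\<close> the move 121 to 211 becomes 221 to 212. This is why \<open>theta\<close>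
  unites both Knuth relations in one function.\<close>

lemma word_f_theta: "word_f i (theta p w) = map_option (theta p) (word_f i w)"
proof (induction p w rule: theta.induct)
  case (1 a b c w)
  show ?case
  proof -
    \<comment> \<open>Letters matter only by their position relative to \<open>i\<close> and
      \<open>Suc i\<close>, and the tail only through \<open>word_f i w\<close> and the small values
      of \<open>wphi i w\<close>; this leaves finitely many cases.\<close>
    have dich: "x < i \<and> x \<noteq> i \<and> x \<noteq> Suc i \<or> x = i \<or> x = Suc i \<or>
        Suc i < x \<and> x \<noteq> i \<and> x \<noteq> Suc i" for x
      by auto
    have k: "wphi i w = 0 \<and> word_f i w = None \<or> (\<exists>v. word_f i w = Some v \<and>
        (wphi i w = Suc 0 \<or> wphi i w = Suc (Suc 0) \<or> (\<exists>k. wphi i w = Suc (Suc (Suc k)))))"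
      by (metis not0_implies_Suc not_None_eq word_f_None_iff)
    show ?thesis
      using dich[of a] dich[of b] dich[of c] k
      by (elim disjE exE conjE; simp)
  qed
next
  case (2 p a w)
  then show ?case by (cases "word_f i w") auto
qed (auto split: if_splits)

lemma word_e_theta: "word_e i (theta p w) = map_option (theta p) (word_e i w)"
proof (cases "word_e i w")
  case None
  show ?thesis
  proof (cases "word_e i (theta p w)")
    case (Some v)
    then have "word_f i v = Some (theta p w)" by (simp add: word_e_iff_f)
    then have "word_f i (theta p v) = Some w" by (simp add: word_f_theta)
    then show ?thesis using None by (simp flip: word_e_iff_f)
  qed (use None in simp)
next
  case (Some v)
  then have "word_f i (theta p v) = Some (theta p w)" by (simp add: word_e_iff_f word_f_theta)
  then show ?thesis using Some by (simp flip: word_e_iff_f)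
qed

section \<open>Plactic equivalence and the automorphisms it induces\<close>

definition plactic :: "nat list \<Rightarrow> nat list \<Rightarrow> bool" where
  "plactic = (\<lambda>u v. \<exists>p. v = theta p u)\<^sup>*\<^sup>*"

lemma plactic_refl [simp]: "plactic u u"
  by (simp add: plactic_def)

lemma plactic_trans [trans]: "plactic u v \<Longrightarrow> plactic v w \<Longrightarrow> plactic u w"
  unfolding plactic_def by (rule rtranclp_trans)

lemma plactic_sym: "plactic u v \<Longrightarrow> plactic v u"
  unfolding plactic_def
  by (rule sympD[OF symp_rtranclp]) (auto intro!: sympI, metis theta_theta)

lemma plactic_theta: "plactic u (theta p u)"
  unfolding plactic_def by blast

lemma plactic_induct [consumes 1, case_names base step]:
  assumes "plactic u v" "P u" "\<And>v p. plactic u v \<Longrightarrow> P v \<Longrightarrow> P (theta p v)"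
  shows "P v"
  using assms unfolding plactic_def by (induction rule: rtranclp_induct) auto

lemma plactic_Cons: "plactic u v \<Longrightarrow> plactic (x # u) (x # v)"
proof (induction rule: plactic_induct)
  case (step v p)
  then show ?case using plactic_trans[OF _ plactic_theta[of "x # v" "Suc p"]] by simp
qed simp

lemma plactic_append_left: "plactic u v \<Longrightarrow> plactic (w @ u) (w @ v)"
  by (induction w) (auto intro: plactic_Cons)

lemma theta_append: "length u > p + 2 \<Longrightarrow> theta p (u @ v) = theta p u @ v"
  by (induction p u rule: theta.induct) auto

lemma theta_short: "length u \<le> p + 2 \<Longrightarrow> theta p u = u"
  by (induction p u rule: theta.induct) auto

lemma plactic_append_right: "plactic u v \<Longrightarrow> plactic (u @ w) (v @ w)"
proof (induction rule: plactic_induct)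
  case (step v p)
  show ?case
  proof (cases "length v > p + 2")
    case True
    then show ?thesis using plactic_trans[OF step.IH plactic_theta[of "v @ w" p]] theta_append by simp
  next
    case False
    then show ?thesis using step.IH theta_short by simp
  qed
qed simp

lemma knuth_right: "c < a \<Longrightarrow> a \<le> b \<Longrightarrow> plactic (a # b # c # w) (a # c # b # w)"
  using plactic_theta[of "a # b # c # w" 0] by simp

lemma knuth_left: "a \<le> c \<Longrightarrow> c < b \<Longrightarrow> plactic (a # b # c # w) (b # a # c # w)"
  using plactic_theta[of "a # b # c # w" 0] by simp

text \<open>The list of positions that leads from \<open>u\<close> to \<open>v\<close> can be
  applied to every word. The composite is bijective since each \<open>theta p\<close> is an
  involution, and it commutes with the operators since each \<open>theta p\<close> does.\<close>

lemma plactic_automorphism: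
  assumes "plactic u v"
  obtains h k where "h u = v" "\<And>w. h (k w) = w" "\<And>w. k (h w) = w"
    "\<And>w j. count_list (h w) j = count_list w j"
    "\<And>i w. word_f i (h w) = map_option h (word_f i w)"
    "\<And>i w. word_e i (h w) = map_option h (word_e i w)"
proof -
  have "\<exists>h k. h u = v \<and> (\<forall>w. h (k w) = w) \<and> (\<forall>w. k (h w) = w) \<and>
    (\<forall>w j. count_list (h w) j = count_list w j) \<and>
    (\<forall>i w. word_f i (h w) = map_option h (word_f i w)) \<and>
    (\<forall>i w. word_e i (h w) = map_option h (word_e i w))"
    using assms
  proof (induction rule: plactic_induct)
    case base
    show ?case by (rule exI[of _ id], rule exI[of _ id]) (simp add: option.map_ident)
  next
    case (step v p)
    then obtain h k where h: "h u = v" "\<forall>w. h (k w) = w" "\<forall>w. k (h w) = w"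
      "\<forall>w j. count_list (h w) j = count_list w j"
      "\<forall>i w. word_f i (h w) = map_option h (word_f i w)"
      "\<forall>i w. word_e i (h w) = map_option h (word_e i w)" by blast
    show ?case
      by (rule exI[of _ "theta p \<circ> h"], rule exI[of _ "k \<circ> theta p"])
        (simp add: h word_f_theta word_e_theta option.map_comp comp_def)
  qed
  then show ?thesis using that by blast
qed

section \<open>Normal forms of Yamanouchi words\<close>

fun column :: "nat \<Rightarrow> nat list" where
  "column 0 = []"
| "column (Suc k) = Suc k # column k"

text \<open>The letter in front of \<open>z\<close> is the witness of the Knuth relation:
  \<open>z\<close> is at least as large and the next letter is smaller, so \<open>z\<close> jumps
  over the next letter, which becomes the new witness.\<close>

lemma letter_past_column_aux:
  "Suc j \<le> z \<Longrightarrow> plactic (Suc j # z # column j) (Suc j # column j @ [z])"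
proof (induction j)
  case (Suc j)
  have "plactic (Suc (Suc j) # z # column (Suc j)) (Suc (Suc j) # Suc j # z # column j)"
    using knuth_right[of "Suc j" "Suc (Suc j)" z] Suc.prems by simp
  also have "plactic \<dots> (Suc (Suc j) # Suc j # column j @ [z])"
    by (rule plactic_Cons, rule Suc.IH) (use Suc.prems in simp)
  finally show ?case by simp
qed simp

text \<open>While the letter to be passed exceeds \<open>x\<close>, the letter after it is at least
  \<open>x\<close> and serves as witness on the right. Once \<open>x\<close> meets its own value,
  \<open>letter_past_column_aux\<close> takes over with the witness on the left.\<close>

lemma letter_past_column:
  "0 < x \<Longrightarrow> x \<le> k \<Longrightarrow> plactic (x # column k) (column k @ [x])"
proof (induction k)
  case (Suc k)
  show ?case
  proof (cases "x = Suc k")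
    case True
    then show ?thesis using letter_past_column_aux[of k "Suc k"] by simp
  next
    case False
    then have "x \<le> k" using Suc.prems by simp
    then obtain k' where k': "k = Suc k'" "x \<le> Suc k'" using Suc.prems by (cases k) auto
    have "plactic (x # column (Suc k)) (Suc k # x # column k)"
      using knuth_left[of x k "Suc k" "column k'"] k' by simp
    also have "plactic \<dots> (Suc k # column k @ [x])"
      by (rule plactic_Cons, rule Suc.IH) (use Suc.prems \<open>x \<le> k\<close> in auto)
    finally show ?thesis by simp
  qed
qed simp

fun canonical :: "nat \<Rightarrow> (nat \<Rightarrow> nat) \<Rightarrow> nat list" where
  "canonical 0 c = []"
| "canonical (Suc k) c = replicate (c (Suc k)) (Suc k) @ canonical k c"

lemma canonical_cong: "(\<And>j. 0 < j \<Longrightarrow> j \<le> k \<Longrightarrow> c j = c' j) \<Longrightarrow> canonical k c = canonical k c'"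
  by (induction k) auto

text \<open>One copy of \<open>Suc k\<close> completes the column extracted from the smaller
  letters; the remaining copies stand in front of it and pass it by
  \<open>letter_past_column\<close>.\<close>

lemma canonical_split_column:
  "(\<And>j. 0 < j \<Longrightarrow> j \<le> k \<Longrightarrow> 0 < c j) \<Longrightarrow>
   plactic (canonical k c) (column k @ canonical k (\<lambda>j. c j - 1))"
proof (induction k)
  case (Suc k)
  have pass: "plactic (replicate m (Suc k) @ column (Suc k)) (column (Suc k) @ replicate m (Suc k))" for m
  proof (induction m)
    case (Suc m)
    have "plactic (replicate (Suc m) (Suc k) @ column (Suc k)) (Suc k # column (Suc k) @ replicate m (Suc k))"
      using plactic_Cons[OF Suc.IH, of "Suc k"] by simp
    also have "plactic \<dots> ((column (Suc k) @ [Suc k]) @ replicate m (Suc k))"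
      using plactic_append_right[OF letter_past_column[of "Suc k" "Suc k"], of "replicate m (Suc k)"]
      by simp
    finally show ?case by simp
  qed simp
  obtain m where m: "c (Suc k) = Suc m" using Suc.prems[of "Suc k"] by (cases "c (Suc k)") auto
  let ?d = "\<lambda>j. c j - 1"
  have "plactic (canonical k c) (column k @ canonical k ?d)"
    by (rule Suc.IH) (use Suc.prems in auto)
  then have "plactic (canonical (Suc k) c) (replicate (Suc m) (Suc k) @ column k @ canonical k ?d)"
    using plactic_append_left[of _ _ "replicate (Suc m) (Suc k)"] m by simp
  also have "replicate (Suc m) (Suc k) @ column k @ canonical k ?d
      = (replicate m (Suc k) @ column (Suc k)) @ canonical k ?d"
    by (simp add: replicate_app_Cons_same)
  also have "plactic \<dots> ((column (Suc k) @ replicate m (Suc k)) @ canonical k ?d)"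
    by (rule plactic_append_right[OF pass])
  finally show ?case using m by simp
qed simp

text \<open>If \<open>c k\<close> is positive, so are all counts: a full column is pulled out,
  \<open>x\<close> passes it and is inserted into the shorter word, and the column is put back. If
  \<open>c k = 0\<close>, either \<open>x = k\<close> already stands in its place or
  \<open>k\<close> can be lowered. The measure decreases in both recursive cases.\<close>

lemma canonical_insert:
  assumes "0 < x" "x \<le> k" "\<And>j. 0 < j \<Longrightarrow> j < k \<Longrightarrow> c (Suc j) \<le> c j"
    "1 < x \<Longrightarrow> c x < c (x - 1)"
  shows "plactic (x # canonical k c) (canonical k (c(x := Suc (c x))))"
  using assms
proof (induction "k + (\<Sum>j\<in>{1..k}. c j)" arbitrary: c k rule: less_induct)
  case less
  have mono: "0 < j \<Longrightarrow> j \<le> l \<Longrightarrow> l \<le> k \<Longrightarrow> c l \<le> c j" for j l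
  proof (induction l)
    case (Suc l)
    show ?case
    proof (cases "j = Suc l")
      case False
      then have "c l \<le> c j" using Suc by simp
      moreover have "c (Suc l) \<le> c l" using less.prems(3)[of l] Suc False by simp
      ultimately show ?thesis by simp
    qed simp
  qed simp
  show ?case
  proof (cases "c k = 0")
    case True
    obtain k' where k': "k = Suc k'" using less.prems by (cases k) auto
    show ?thesis
    proof (cases "x = k")
      case True
      have "canonical k' (c(x := Suc (c x))) = canonical k' c"
        by (rule canonical_cong) (use True k' in auto)
      then show ?thesis using True k' \<open>c k = 0\<close> by simp
    next
      case False
      have "plactic (x # canonical k' c) (canonical k' (c(x := Suc (c x))))"
        by (rule less.hyps) (use k' less.prems False in auto)
      then show ?thesis using False k' \<open>c k = 0\<close> by simp
    qed
  next
    case False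
    define d where "d = (\<lambda>j. c j - 1)"
    have pos: "0 < j \<Longrightarrow> j \<le> k \<Longrightarrow> 0 < c j" for j using mono[of j k] False by simp
    have "(\<Sum>j\<in>{1..k}. d j) < (\<Sum>j\<in>{1..k}. c j)"
      by (rule sum_strict_mono_ex1) (use False less.prems in \<open>auto simp: d_def intro!: bexI[of _ k]\<close>)
    \<comment> \<open>All counts up to \<open>k\<close> are positive, so truncated subtraction keeps
      the strict inequality.\<close>
    moreover have "d x < d (x - 1)" if "1 < x"
      using less.prems(4) pos[of x] less.prems that by (simp add: d_def)
    ultimately have IH: "plactic (x # canonical k d) (canonical k (d(x := Suc (d x))))"
      using less.prems by (intro less.hyps) (auto simp: d_def intro: diff_le_mono)
    have "plactic (x # canonical k c) (x # column k @ canonical k d)"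
      unfolding d_def by (rule plactic_Cons, rule canonical_split_column, rule pos)
    also have "plactic \<dots> (column k @ x # canonical k d)"
      using plactic_append_right[OF letter_past_column[of x k]] less.prems by simp
    also have "plactic \<dots> (column k @ canonical k (d(x := Suc (d x))))"
      by (rule plactic_append_left[OF IH])
    also have "canonical k (d(x := Suc (d x))) = canonical k (\<lambda>j. (c(x := Suc (c x))) j - 1)"
      by (rule canonical_cong) (use less.prems pos in \<open>auto simp: d_def\<close>)
    also have "plactic (column k @ \<dots>) (canonical k (c(x := Suc (c x))))"
      by (rule plactic_sym, rule canonical_split_column) (use pos in auto)
    finally show ?thesis .
  qed
qed

definition yamanouchi_word :: "nat \<Rightarrow> nat list \<Rightarrow> bool" where
  "yamanouchi_word n w \<longleftrightarrow> (\<forall>i\<in>{1..<n}. word_e i w = None)"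

text \<open>With no surviving -, every \<open>Suc i\<close> is cancelled by its own
  \<open>i\<close>, and the other \<open>i\<close> are the surviving +.\<close>

lemma wphi_if_word_e_None:
  "word_e i w = None \<Longrightarrow> count_list w i = wphi i w + count_list w (Suc i)"
  by (induction w) (auto split: if_splits)

lemma word_e_Cons_None_iff:
  "word_e i (x # w) = None \<longleftrightarrow> word_e i w = None \<and> \<not> (x = Suc i \<and> wphi i w = 0)"
  by auto

lemma yamanouchi_word_Cons:
  "yamanouchi_word n (x # w) \<Longrightarrow> yamanouchi_word n w"
  unfolding yamanouchi_word_def word_e_Cons_None_iff by blast

lemma yamanouchi_word_count:
  "yamanouchi_word n w \<Longrightarrow> 0 < i \<Longrightarrow> i < n \<Longrightarrow> count_list w (Suc i) \<le> count_list w i"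
  using wphi_if_word_e_None[of i w] by (simp add: yamanouchi_word_def)

lemma yamanouchi_word_Cons_less:
  assumes "yamanouchi_word n (x # w)" "1 < x" "x \<le> n"
  shows "count_list w x < count_list w (x - 1)"
proof -
  obtain i where i: "x = Suc i" using assms by (cases x) auto
  have "word_e i (x # w) = None" using assms i unfolding yamanouchi_word_def by (auto simp del: word_e.simps)
  then have "wphi i w \<noteq> 0" "word_e i w = None" using i by (auto split: if_splits)
  then show ?thesis using wphi_if_word_e_None[of i w] i by simp
qed

text \<open>Suffixes of Yamanouchi words are Yamanouchi, so the word can be built from the right.
  The strict inequality that \<open>canonical_insert\<close> asks for holds because the new letter
  \<open>x\<close> must be cancelled by a surviving \<open>x - 1\<close> of the tail.\<close>

lemma plactic_canonical:
  "yamanouchi_word n w \<Longrightarrow> set w \<subseteq> {1..n} \<Longrightarrow> plactic w (canonical n (count_list w))"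
proof (induction w)
  case Nil
  have "canonical n (\<lambda>_. 0) = []" by (induction n) auto
  then show ?case by (simp add: fun_eq_iff[symmetric])
next
  case (Cons x w)
  have w: "yamanouchi_word n w" by (rule yamanouchi_word_Cons[OF Cons.prems(1)])
  have "plactic (x # w) (x # canonical n (count_list w))"
    by (rule plactic_Cons, rule Cons.IH) (use w Cons.prems in auto)
  also have "plactic \<dots> (canonical n ((count_list w)(x := Suc (count_list w x))))"
    by (rule canonical_insert)
      (use Cons.prems w yamanouchi_word_count yamanouchi_word_Cons_less in auto)
  also have "(count_list w)(x := Suc (count_list w x)) = count_list (x # w)"
    by auto
  finally show ?case .
qed

section \<open>Signatures of columns\<close>

definition plus_part :: "(nat \<times> sign) list \<Rightarrow> (nat \<times> sign) list" where
  "plus_part w = filter (\<lambda>x. snd x = Plus) (reduced w)"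

definition minus_part :: "(nat \<times> sign) list \<Rightarrow> (nat \<times> sign) list" where
  "minus_part w = filter (\<lambda>x. snd x = Minus) (reduced w)"

lemma sign_neq_iff: "s \<noteq> Plus \<longleftrightarrow> s = Minus"
  by (cases s) auto

lemma parts_Nil [simp]: "plus_part [] = []" "minus_part [] = []"
  by (simp_all add: plus_part_def minus_part_def)

text \<open>A reduced word is a block of + followed by a block of -, so a new leading - can only
  cancel the first +, and it survives exactly when there is none.\<close>

lemma parts_Cons [simp]:
  "plus_part (x # w) = (if snd x = Plus then x # plus_part w else tl (plus_part w))"
  "minus_part (x # w) =
     (if snd x = Minus \<and> plus_part w = [] then x # minus_part w else minus_part w)"
proof -
  obtain p m where pm: "reduced w = p @ m" "\<forall>x\<in>set p. snd x = Plus" "\<forall>x\<in>set m. snd x = Minus"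
    using reduced_shape by blast
  have "plus_part w = p" "minus_part w = m"
    using pm by (auto simp: plus_part_def minus_part_def filter_id_conv filter_empty_conv)
  then show "plus_part (x # w) = (if snd x = Plus then x # plus_part w else tl (plus_part w))"
    "minus_part (x # w) =
       (if snd x = Minus \<and> plus_part w = [] then x # minus_part w else minus_part w)"
    using pm unfolding plus_part_def minus_part_def
    by (cases p; cases m; simp add: sign_neq_iff)+
qed

definition column_diff :: "nat \<Rightarrow> filling \<Rightarrow> nat \<Rightarrow> int" where
  "column_diff i T c = of_bool (in_column i c T) - of_bool (in_column (Suc i) c T)"

definition columns_diff :: "nat \<Rightarrow> filling \<Rightarrow> nat \<Rightarrow> nat \<Rightarrow> int" where
  "columns_diff i T k c = (\<Sum>j\<in>{k..<c}. column_diff i T j)"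

lemma columns_diff_same [simp]: "columns_diff i T k k = 0"
  by (simp add: columns_diff_def)

lemma columns_diff_first:
  "k < c \<Longrightarrow> columns_diff i T k c = column_diff i T k + columns_diff i T (Suc k) c"
  by (simp add: columns_diff_def sum.atLeast_Suc_lessThan)

lemma columns_diff_last:
  "k \<le> c \<Longrightarrow> columns_diff i T k (Suc c) = columns_diff i T k c + column_diff i T c"
  by (simp add: columns_diff_def)

text \<open>Here \<open>s\<close> is a height function on \<open>{k..m}\<close>, with a step up, down or none in each column, and
  \<open>ps\<close>, \<open>ms\<close> are the surviving signs $+$ and $-$. Their number and the columns in which the operators act
  are read off the maximum of \<open>s\<close>: the last $+$ is the step at which it is first attained, the first
  $-$ the step after it is last attained.\<close>

definition peaks ::
    "nat \<Rightarrow> nat \<Rightarrow> (nat \<Rightarrow> int) \<Rightarrow> (nat \<times> sign) list \<Rightarrow> (nat \<times> sign) list \<Rightarrow> bool" where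
  "peaks k m s ps ms \<longleftrightarrow>
     (\<forall>c. k \<le> c \<and> c \<le> m \<longrightarrow> s c \<le> int (length ps)) \<and>
     (ps \<noteq> [] \<longrightarrow> k \<le> fst (last ps) \<and> fst (last ps) < m \<and> s (Suc (fst (last ps))) = int (length ps) \<and>
        (\<forall>c. k \<le> c \<and> c \<le> fst (last ps) \<longrightarrow> s c < int (length ps))) \<and>
     (ms \<noteq> [] \<longrightarrow> k \<le> fst (hd ms) \<and> fst (hd ms) < m \<and> s (fst (hd ms)) = int (length ps) \<and>
        (\<forall>c. fst (hd ms) < c \<and> c \<le> m \<longrightarrow> s c < int (length ps))) \<and>
     (ms = [] \<longrightarrow> s m = int (length ps))"

text \<open>A new column on the left shifts all later heights by \<open>e\<close>. For
  \<open>e = - 1\<close> with some + surviving, the loss of the first + lowers the maximum in step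
  with the shift. With no + surviving, the start \<open>k\<close> becomes the only place of height 0
  and all later heights are negative, so the new - is the first one.\<close>

lemma peaks_step:
  assumes P: "peaks (Suc k) m s ps ms" and m: "Suc k \<le> m"
    and s: "\<And>c. k < c \<Longrightarrow> s' c = e + s c" "s' k = 0" "s (Suc k) = 0"
    and e: "e = 0 \<and> ps' = ps \<and> ms' = ms \<or> e = 1 \<and> ps' = (k, Plus) # ps \<and> ms' = ms \<or>
      e = - 1 \<and> ps' = tl ps \<and> ms' = (if ps = [] then (k, Minus) # ms else ms)"
  shows "peaks k m s' ps' ms'"
proof -
  have bound: "s c \<le> int (length ps)" if "Suc k \<le> c" "c \<le> m" for c
    using P that by (simp add: peaks_def)
  have last: "Suc k \<le> fst (last ps)" "fst (last ps) < m" "s (Suc (fst (last ps))) = int (length ps)"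
    "\<And>c. Suc k \<le> c \<Longrightarrow> c \<le> fst (last ps) \<Longrightarrow> s c < int (length ps)" if "ps \<noteq> []"
    using P that by (simp_all add: peaks_def)
  have first: "Suc k \<le> fst (hd ms)" "fst (hd ms) < m" "s (fst (hd ms)) = int (length ps)"
    "\<And>c. fst (hd ms) < c \<Longrightarrow> c \<le> m \<Longrightarrow> s c < int (length ps)" if "ms \<noteq> []"
    using P that by (simp_all add: peaks_def)
  have none: "s m = int (length ps)" if "ms = []"
    using P that by (simp add: peaks_def)
  from e show ?thesis
  proof (elim disjE conjE)
    assume e: "e = 0" "ps' = ps" "ms' = ms"
    have "s' c = (if c = k then 0 else s c)" if "k \<le> c" for c using s e that by simp
    then show ?thesis unfolding peaks_def e(2,3)
      using bound last first none m by (auto simp: Suc_le_eq)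
  next
    assume e: "e = 1" "ps' = (k, Plus) # ps" "ms' = ms"
    have "s' c = (if c = k then 0 else 1 + s c)" if "k \<le> c" for c using s e that by simp
    then show ?thesis unfolding peaks_def e(2,3)
      using bound last first none m s(3) by (auto simp: Suc_le_eq)
  next
    assume e: "e = - 1" "ps' = tl ps" "ms' = (if ps = [] then (k, Minus) # ms else ms)"
    have s': "s' c = (if c = k then 0 else s c - 1)" if "k \<le> c" for c using s e that by simp
    show ?thesis
    proof (cases ps)
      case Nil
      have "s c \<le> 1" "s c < 1" if "Suc k \<le> c" "c \<le> m" for c using bound[OF that] Nil by simp_all
      then show ?thesis unfolding peaks_def e(2,3)
        using Nil s' m by (auto simp: Suc_le_eq)
    next
      case (Cons x qs)
      have "s c - 1 \<le> int (length qs)" if "Suc k \<le> c" "c \<le> m" for c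
        using bound[OF that] Cons by simp
      moreover have "s c - 1 < int (length qs)" if "Suc k \<le> c" "c \<le> fst (last qs)" "qs \<noteq> []" for c
        using last(4)[of c] that Cons by simp
      moreover have "s c - 1 < int (length qs)" if "fst (hd ms) < c" "c \<le> m" "ms \<noteq> []" for c
        using first(4)[of c] that Cons by simp
      ultimately show ?thesis unfolding peaks_def e(2,3)
        using Cons s' last(1-3) first(1-3) none m by (auto simp: Suc_le_eq)
    qed
  qed
qed

lemma peaks_signature:
  assumes "k \<le> m"
  shows "peaks k m (columns_diff i T k) (plus_part (concat (map (column_sign i T) [k..<m])))
    (minus_part (concat (map (column_sign i T) [k..<m])))"
  using assms
proof (induction rule: inc_induct)
  case base
  have "c = m" if "m \<le> c \<and> c \<le> m" for c using that by simp
  then show ?case by (auto simp: peaks_def)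
next
  case (step k)
  have w: "concat (map (column_sign i T) [k..<m]) =
      column_sign i T k @ concat (map (column_sign i T) [Suc k..<m])"
    using step.hyps by (simp add: upt_conv_Cons)
  have "column_sign i T k = [] \<and> column_diff i T k = 0 \<or>
      column_sign i T k = [(k, Plus)] \<and> column_diff i T k = 1 \<or>
      column_sign i T k = [(k, Minus)] \<and> column_diff i T k = - 1"
    by (auto simp: column_sign_def column_diff_def)
  then show ?case unfolding w
    by (intro peaks_step[OF step.IH, where e = "column_diff i T k"])
      (use step.hyps in \<open>auto simp: columns_diff_first\<close>)
qed

section \<open>Elementary properties of set-valued tableaux\<close>

lemma SVT_iff:
  "T \<in> SVT n lam \<longleftrightarrow>
     (\<forall>b \<in> diagram lam. T b \<noteq> {} \<and> T b \<subseteq> {1..n}) \<and>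
     (\<forall>b. b \<notin> diagram lam \<longrightarrow> T b = {}) \<and>
     (\<forall>r c c' x y. x \<in> T (r, c) \<and> y \<in> T (r, c') \<and> c < c' \<longrightarrow> x \<le> y) \<and>
     (\<forall>r r' c x y. x \<in> T (r, c) \<and> y \<in> T (r', c) \<and> r < r' \<longrightarrow> x < y)"
  (is "?L \<longleftrightarrow> ?A \<and> ?B \<and> ?R \<and> ?C")
proof
  assume L: ?L
  then have A: ?A and B: ?B
    and S: "\<And>S. (\<forall>b \<in> diagram lam. S b \<in> T b) \<Longrightarrow> semistandard lam S"
    by (simp_all add: SVT_def)
  \<comment> \<open>Every box is nonempty, so any two entries of different boxes extend to a choice;
    the quantifier over choices becomes a condition on pairs of entries.\<close>
  have choose: "\<exists>S. (\<forall>b \<in> diagram lam. S b \<in> T b) \<and> S b1 = x \<and> S b2 = y"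
    if "x \<in> T b1" "y \<in> T b2" "b1 \<noteq> b2" for b1 b2 x y
    using that A
    by (intro exI[of _ "(\<lambda>b. SOME z. z \<in> T b)(b1 := x, b2 := y)"]) (auto simp: some_in_eq)
  have ?R
  proof (intro allI impI, elim conjE)
    fix r c c' x y assume h: "x \<in> T (r, c)" "y \<in> T (r, c')" "c < (c'::nat)"
    then obtain S where "semistandard lam S" "S (r, c) = x" "S (r, c') = y"
      using choose[OF h(1,2)] S by auto
    moreover have "(r, c) \<in> diagram lam" "(r, c') \<in> diagram lam" using h B by auto
    ultimately show "x \<le> y" using h unfolding semistandard_def by blast
  qed
  moreover have ?C
  proof (intro allI impI, elim conjE)
    fix r r' c x y assume h: "x \<in> T (r, c)" "y \<in> T (r', c)" "r < (r'::nat)"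
    then obtain S where "semistandard lam S" "S (r, c) = x" "S (r', c) = y"
      using choose[OF h(1,2)] S by auto
    moreover have "(r, c) \<in> diagram lam" "(r', c) \<in> diagram lam" using h B by auto
    ultimately show "x < y" using h unfolding semistandard_def by blast
  qed
  ultimately show "?A \<and> ?B \<and> ?R \<and> ?C" using A B by simp
next
  assume "?A \<and> ?B \<and> ?R \<and> ?C"
  then have A: ?A and B: ?B and R: ?R and C: ?C by simp_all
  have "semistandard lam S" if S: "\<forall>b \<in> diagram lam. S b \<in> T b" for S
    unfolding semistandard_def
    using S R C by (intro conjI allI impI; elim conjE) meson+
  then show ?L using A B by (simp add: SVT_def)
qed

locale svt =
  fixes n :: nat and lam :: "nat list" and T :: filling
  assumes lam: "is_partition lam" and T: "T \<in> SVT n lam"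
begin

lemma nonempty: "b \<in> diagram lam \<Longrightarrow> \<exists>x. x \<in> T b"
  using T unfolding SVT_iff by blast

lemma entry_in_diagram: "x \<in> T b \<Longrightarrow> b \<in> diagram lam"
  using T unfolding SVT_iff by blast

lemma entry_range: "x \<in> T b \<Longrightarrow> 1 \<le> x \<and> x \<le> n"
  using T entry_in_diagram[of x b] unfolding SVT_iff by (metis atLeastAtMost_iff subsetD)

lemma row_le: "x \<in> T (r, c) \<Longrightarrow> y \<in> T (r, c') \<Longrightarrow> c < c' \<Longrightarrow> x \<le> y"
  using T unfolding SVT_iff by blast

lemma column_less: "x \<in> T (r, c) \<Longrightarrow> y \<in> T (r', c) \<Longrightarrow> r < r' \<Longrightarrow> x < y"
  using T unfolding SVT_iff by blast

lemma column_unique: "x \<in> T (r, c) \<Longrightarrow> x \<in> T (r', c) \<Longrightarrow> r = r'"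
  using column_less by (metis less_irrefl linorder_neqE_nat)

lemma diagram_mono: "(r, c) \<in> diagram lam \<Longrightarrow> r' \<le> r \<Longrightarrow> c' \<le> c \<Longrightarrow> (r', c') \<in> diagram lam"
proof -
  assume h: "(r, c) \<in> diagram lam" "r' \<le> r" "c' \<le> c"
  have "lam ! r \<le> lam ! r'"
    using h lam by (cases "r' = r") (auto simp: is_partition_def diagram_def sorted_wrt_iff_nth_less)
  then show ?thesis using h by (auto simp: diagram_def)
qed

lemma row_of_eq: "x \<in> T (r, c) \<Longrightarrow> row_of x c T = r"
  unfolding row_of_def using column_unique by blast

lemma in_column_less: "in_column j c T \<Longrightarrow> c < num_columns lam"
proof -
  assume "in_column j c T"
  then obtain r where "(r, c) \<in> diagram lam" using entry_in_diagram by (auto simp: in_column_def)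
  then have "(0, c) \<in> diagram lam" using diagram_mono by blast
  then show ?thesis by (auto simp: diagram_def num_columns_def hd_conv_nth)
qed

end

section \<open>The tableau operators as changes at a peak of the height function\<close>

abbreviation height :: "nat \<Rightarrow> filling \<Rightarrow> nat \<Rightarrow> int" where
  "height i T \<equiv> columns_diff i T 0"

text \<open>Both operators act at the step from \<open>c\<close> to \<open>c + 1\<close> when this is the first step reaching the
  maximal height (for $f_i$), or the first step leaving it for good (for $e_i$).\<close>

definition peak_step :: "nat \<Rightarrow> filling \<Rightarrow> nat \<Rightarrow> bool" where
  "peak_step i T c \<longleftrightarrow>
     (\<forall>c'\<le>c. height i T c' \<le> height i T c) \<and> (\<forall>c'>c. height i T c' \<le> height i T (Suc c))"

definition f_at :: "nat \<Rightarrow> nat \<Rightarrow> nat \<Rightarrow> filling \<Rightarrow> filling" where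
  "f_at i r c T =
     (if i \<notin> T (r, c + 1) then T((r, c) := insert (i + 1) (T (r, c) - {i}))
      else T((r, c + 1) := T (r, c + 1) - {i}, (r, c) := insert (i + 1) (T (r, c))))"

definition e_at :: "nat \<Rightarrow> nat \<Rightarrow> nat \<Rightarrow> filling \<Rightarrow> filling" where
  "e_at i r c T =
     (if c = 0 \<or> i + 1 \<notin> T (r, c - 1) then T((r, c) := insert i (T (r, c) - {i + 1}))
      else T((r, c - 1) := T (r, c - 1) - {i + 1}, (r, c) := insert i (T (r, c))))"

definition f_box :: "nat \<Rightarrow> filling \<Rightarrow> nat \<Rightarrow> nat \<Rightarrow> bool" where
  "f_box i T r c \<longleftrightarrow> i \<in> T (r, c) \<and> \<not> in_column (Suc i) c T \<and> peak_step i T c"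

definition e_box :: "nat \<Rightarrow> filling \<Rightarrow> nat \<Rightarrow> nat \<Rightarrow> bool" where
  "e_box i T r c \<longleftrightarrow> Suc i \<in> T (r, c) \<and> \<not> in_column i c T \<and> peak_step i T c"

lemma f_box_height:
  "f_box i T r c \<Longrightarrow> height i T (Suc c) = height i T c + 1"
  by (auto simp: f_box_def columns_diff_last column_diff_def in_column_def)

lemma e_box_height:
  "e_box i T r c \<Longrightarrow> height i T (Suc c) = height i T c - 1"
  by (auto simp: e_box_def columns_diff_last column_diff_def in_column_def)

context svt
begin

lemma height_beyond: "num_columns lam \<le> c \<Longrightarrow> height i T c = height i T (num_columns lam)"
proof (induction rule: dec_induct)
  case (step c)
  then show ?case using in_column_less[of _ c]
    by (fastforce simp: columns_diff_last column_diff_def)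
qed simp

lemma column_of_height_up:
  assumes "height i T (Suc c) > height i T c"
  shows "in_column i c T" "\<not> in_column (Suc i) c T"
  using assms by (auto simp: columns_diff_last column_diff_def split: if_splits)

lemma column_of_height_down:
  assumes "height i T (Suc c) < height i T c"
  shows "in_column (Suc i) c T" "\<not> in_column i c T"
  using assms by (auto simp: columns_diff_last column_diff_def split: if_splits)

lemma svt_f_cases:
  obtains (None) "svt_f lam i T = None" "\<And>c. height i T c \<le> 0"
    | (Some) r c where "f_box i T r c" "svt_f lam i T = Some (f_at i r c T)"
proof -
  define ps where "ps = plus_part (signature lam i T)"
  define m where "m = num_columns lam"
  have pk: "peaks 0 m (height i T) ps (minus_part (signature lam i T))"
    using peaks_signature[of 0 m i T] by (simp add: ps_def m_def signature_def)
  have le: "height i T c \<le> int (length ps)" for c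
    using pk height_beyond[of c i] by (cases "c \<le> m") (auto simp: peaks_def m_def)
  show ?thesis
  proof (cases "ps = []")
    case True
    then have "svt_f lam i T = None" by (simp add: svt_f_def ps_def plus_part_def Let_def)
    then show ?thesis using None le True by simp
  next
    case False
    define c where "c = fst (last ps)"
    have c: "height i T (Suc c) = int (length ps)" "\<And>c'. c' \<le> c \<Longrightarrow> height i T c' < int (length ps)"
      using pk False by (auto simp: peaks_def c_def)
    have up: "height i T (Suc c) > height i T c" using c by simp
    obtain r where r: "i \<in> T (r, c)" using column_of_height_up(1)[OF up] by (auto simp: in_column_def)
    have "height i T (Suc c) = height i T c + 1"
      using column_of_height_up[OF up] by (simp add: columns_diff_last column_diff_def)
    then have "height i T c' \<le> height i T c" if "c' \<le> c" for c' using c(1) c(2)[OF that] by simp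
    then have "f_box i T r c"
      using r column_of_height_up(2)[OF up] le c(1) by (auto simp: f_box_def peak_step_def)
    moreover have "svt_f lam i T = Some (f_at i r c T)"
      using False row_of_eq[OF r]
      by (simp add: svt_f_def f_at_def Let_def c_def ps_def plus_part_def)
    ultimately show ?thesis by (rule Some)
  qed
qed

lemma svt_e_cases:
  obtains (None) "svt_e lam i T = None" "\<And>c. height i T c \<le> height i T (num_columns lam)"
    | (Some) r c where "e_box i T r c" "svt_e lam i T = Some (e_at i r c T)"
proof -
  define ps where "ps = plus_part (signature lam i T)"
  define ms where "ms = minus_part (signature lam i T)"
  define m where "m = num_columns lam"
  have pk: "peaks 0 m (height i T) ps ms"
    using peaks_signature[of 0 m i T] by (simp add: ps_def ms_def m_def signature_def)
  have le: "height i T c \<le> int (length ps)" for c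
    using pk height_beyond[of c i] by (cases "c \<le> m") (auto simp: peaks_def m_def)
  show ?thesis
  proof (cases "ms = []")
    case True
    then have "svt_e lam i T = None" by (simp add: svt_e_def ms_def minus_part_def Let_def)
    then show ?thesis using None le True pk by (simp add: peaks_def m_def)
  next
    case False
    define c where "c = fst (hd ms)"
    have c: "c < m" "height i T c = int (length ps)"
      "\<And>c'. c < c' \<Longrightarrow> c' \<le> m \<Longrightarrow> height i T c' < int (length ps)"
      using pk False by (auto simp: peaks_def c_def)
    have c': "height i T c' < int (length ps)" if "c < c'" for c'
      using c height_beyond[of c' i] that by (cases "c' \<le> m") (auto simp: m_def)
    have down: "height i T (Suc c) < height i T c" using c by simp
    obtain r where r: "Suc i \<in> T (r, c)"
      using column_of_height_down(1)[OF down] by (auto simp: in_column_def)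
    have "height i T (Suc c) = height i T c - 1"
      using column_of_height_down[OF down] by (simp add: columns_diff_last column_diff_def)
    then have "height i T c' \<le> height i T (Suc c)" if "c < c'" for c' using c(2) c'[OF that] by simp
    then have "e_box i T r c"
      using r column_of_height_down(2)[OF down] le c(2) by (auto simp: e_box_def peak_step_def)
    moreover have "svt_e lam i T = Some (e_at i r c T)"
      using False row_of_eq[OF r]
      by (simp add: svt_e_def e_at_def Let_def c_def ms_def minus_part_def)
    ultimately show ?thesis by (rule Some)
  qed
qed

text \<open>A step up at a peak is unique: a later one would have to exceed a height that bounds it.
  This lets \<open>f_of_e_at\<close> identify the box of \<open>f_i\<close> without computing a
  signature.\<close>

lemma svt_f_eq:
  assumes "f_box i T r c"
  shows "svt_f lam i T = Some (f_at i r c T)"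
proof (cases rule: svt_f_cases[of i])
  case None
  have "height i T 0 \<le> height i T c"
    using assms unfolding f_box_def peak_step_def by blast
  then show ?thesis using None(2)[of "Suc c"] f_box_height[OF assms] by simp
next
  case (Some r' c')
  have "\<not> c1 < c2" if "f_box i T r1 c1" "f_box i T r2 c2" for r1 r2 c1 c2
  proof
    assume "c1 < c2"
    then have "height i T (Suc c1) \<le> height i T c2" "height i T (Suc c2) \<le> height i T (Suc c1)"
      using that by (auto simp: f_box_def peak_step_def)
    then show False using f_box_height[OF that(2)] by simp
  qed
  then have "c = c'" using assms Some(1) by (meson linorder_neqE_nat)
  then have "r = r'" using assms Some(1) column_unique by (auto simp: f_box_def)
  then show ?thesis using Some \<open>c = c'\<close> by simp
qed

text \<open>An \<open>i\<close> without \<open>Suc i\<close> in column \<open>Suc c\<close> would be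
  a further step up beyond the peak. So the column contains \<open>Suc i\<close>; if it stood in a
  lower row, the box to its left would be squeezed to contain \<open>Suc i\<close>, which column
  \<open>c\<close> excludes.\<close>

lemma f_box_right:
  assumes f: "f_box i T r c" and i: "i \<in> T (r, Suc c)"
  shows "Suc i \<in> T (r, Suc c)"
proof -
  have "height i T (Suc (Suc c)) \<le> height i T (Suc c)"
    using f by (simp add: f_box_def peak_step_def)
  moreover have "in_column i (Suc c) T" using i by (auto simp: in_column_def)
  ultimately have "in_column (Suc i) (Suc c) T"
    by (cases "in_column (Suc i) (Suc c) T") (auto simp: columns_diff_last[of 0 "Suc c"] column_diff_def)
  then obtain r' where r': "Suc i \<in> T (r', Suc c)" by (auto simp: in_column_def)
  have "\<not> r < r'"
  proof
    assume "r < r'"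
    have "(r', c) \<in> diagram lam" using entry_in_diagram[OF r'] diagram_mono by simp
    then obtain y where y: "y \<in> T (r', c)" using nonempty by blast
    have "i < y" using f column_less[of i r c y r'] y \<open>r < r'\<close> by (simp add: f_box_def)
    moreover have "y \<le> Suc i" using row_le[OF y r'] by simp
    ultimately have "y = Suc i" by simp
    then show False using f y by (auto simp: f_box_def in_column_def)
  qed
  moreover have "\<not> r' < r" using column_less[OF r' i] by auto
  ultimately show ?thesis using r' by (metis linorder_neqE_nat)
qed

lemma f_at_cases:
  assumes "f_box i T r c" "x \<in> f_at i r c T (r', c')"
  shows "x \<in> T (r', c') \<or> x = Suc i \<and> r' = r \<and> c' = c"
  using assms by (auto simp: f_at_def split: if_splits)

text \<open>An \<open>i\<close> beyond column \<open>Suc c\<close> would force \<open>i\<close> into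
  box \<open>(r, Suc c)\<close>, hence \<open>Suc i\<close> too by \<open>f_box_right\<close>, and
  the row would decrease.\<close>

lemma f_at_right:
  assumes "f_box i T r c" "c < c'"
  shows "i \<notin> f_at i r c T (r, c')"
proof
  assume h: "i \<in> f_at i r c T (r, c')"
  then have i: "i \<in> T (r, c')" using f_at_cases[OF assms(1) h] by simp
  show False
  proof (cases "c' = Suc c")
    case True
    then show ?thesis using h i by (auto simp: f_at_def split: if_splits)
  next
    case False
    then have "Suc c < c'" using assms by simp
    moreover have "(r, Suc c) \<in> diagram lam"
      using diagram_mono[OF entry_in_diagram[OF i]] assms(2) by simp
    then obtain z where z: "z \<in> T (r, Suc c)" using nonempty by blast
    ultimately have "z \<le> i" using row_le z i by blast
    moreover have "i \<le> z" using row_le[of i r c z "Suc c"] z assms(1) by (simp add: f_box_def)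
    ultimately have "i \<in> T (r, Suc c)" using z by simp
    from f_box_right[OF assms(1) this] show False using row_le[OF _ i] \<open>Suc c < c'\<close> by fastforce
  qed
qed

text \<open>The new \<open>Suc i\<close> fits its row by \<open>f_at_right\<close> and its column
  because that column had no \<open>Suc i\<close>. If \<open>i\<close> is taken from the box on the
  right, \<open>f_box_right\<close> keeps that box nonempty.\<close>

lemma f_at_SVT:
  assumes f: "f_box i T r c" and i: "0 < i" "i < n"
  shows "f_at i r c T \<in> SVT n lam"
  unfolding SVT_iff
proof (intro conjI allI impI ballI; (elim conjE)?)
  have rc: "i \<in> T (r, c)" and ni: "\<And>r'. Suc i \<notin> T (r', c)"
    using f by (auto simp: f_box_def in_column_def)
  fix b assume b: "b \<in> diagram lam"
  show "f_at i r c T b \<noteq> {}"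
    using nonempty[OF b] f_box_right[OF f] by (auto simp: f_at_def)
  show "f_at i r c T b \<subseteq> {1..n}"
    using f_at_cases[OF f, of _ "fst b" "snd b"] entry_range[of _ b] i
    by (fastforce simp: Suc_le_eq)
next
  fix b assume "b \<notin> diagram lam"
  moreover have "b \<noteq> (r, c)"
    using calculation entry_in_diagram f by (auto simp: f_box_def)
  ultimately show "f_at i r c T b = {}"
    using f_at_cases[OF f, of _ "fst b" "snd b"] entry_in_diagram[of _ b]
    by (cases b) auto
next
  fix r' a b x y
  assume h: "x \<in> f_at i r c T (r', a)" "y \<in> f_at i r c T (r', b)" "a < b"
  from f_at_cases[OF f h(1)] f_at_cases[OF f h(2)] show "x \<le> y"
  proof (elim disjE conjE)
    assume "x = Suc i" "r' = r" "a = c" "y \<in> T (r', b)"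
    then show ?thesis using row_le[of i r c y b] h f f_at_right[OF f, of b]
      by (metis Suc_leI f_box_def le_neq_implies_less)
  next
    assume "x \<in> T (r', a)" "y = Suc i" "r' = r" "b = c"
    then show ?thesis using row_le[of x r a i c] h f by (simp add: f_box_def)
  qed (use h row_le in auto)
next
  fix r1 r2 c' x y
  assume h: "x \<in> f_at i r c T (r1, c')" "y \<in> f_at i r c T (r2, c')" "r1 < r2"
  from f_at_cases[OF f h(1)] f_at_cases[OF f h(2)] show "x < y"
  proof (elim disjE conjE)
    assume "x = Suc i" "r1 = r" "c' = c" "y \<in> T (r2, c')"
    then show ?thesis using column_less[of i r c y r2] h f
      by (metis Suc_lessI f_box_def in_column_def)
  next
    assume "x \<in> T (r1, c')" "y = Suc i" "r2 = r" "c' = c"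
    then show ?thesis using column_less[of x r1 c i r] h f by (simp add: f_box_def)
  qed (use h column_less in auto)
qed

text \<open>Mirror image of \<open>f_box_right\<close>: the step before the peak cannot go down, so
  column \<open>c\<close> contains \<open>i\<close>, and an \<open>i\<close> in a higher row would
  squeeze an \<open>i\<close> into column \<open>Suc c\<close>.\<close>

lemma e_box_left:
  assumes e: "e_box i T r (Suc c)" and i: "Suc i \<in> T (r, c)"
  shows "i \<in> T (r, c)"
proof -
  have "height i T c \<le> height i T (Suc c)"
    using e by (simp add: e_box_def peak_step_def)
  moreover have "in_column (Suc i) c T" using i by (auto simp: in_column_def)
  ultimately have "in_column i c T"
    by (auto simp: columns_diff_last column_diff_def split: if_splits)
  then obtain r' where r': "i \<in> T (r', c)" by (auto simp: in_column_def)
  have e': "Suc i \<in> T (r, Suc c)" using e by (simp add: e_box_def)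
  have "\<not> r' < r"
  proof
    assume "r' < r"
    have "(r', Suc c) \<in> diagram lam"
      using entry_in_diagram[OF e'] diagram_mono \<open>r' < r\<close> by simp
    then obtain y where y: "y \<in> T (r', Suc c)" using nonempty by blast
    have "y < Suc i" using column_less[OF y e'] \<open>r' < r\<close> by simp
    moreover have "i \<le> y" using row_le[OF r' y] by simp
    ultimately have "y = i" by simp
    then show False using e y by (auto simp: e_box_def in_column_def)
  qed
  moreover have "\<not> r < r'" using column_less[OF i r'] by auto
  ultimately show ?thesis using r' by (metis linorder_neqE_nat)
qed

lemma e_at_cases:
  assumes "e_box i T r c" "x \<in> e_at i r c T (r', c')"
  shows "x \<in> T (r', c') \<or> x = i \<and> r' = r \<and> c' = c"
  using assms by (auto simp: e_at_def split: if_splits)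

lemma e_at_left:
  assumes "e_box i T r c" "c' < c"
  shows "Suc i \<notin> e_at i r c T (r, c')"
proof
  assume h: "Suc i \<in> e_at i r c T (r, c')"
  then have i: "Suc i \<in> T (r, c')" using e_at_cases[OF assms(1) h] by simp
  obtain d where d: "c = Suc d" using assms by (cases c) auto
  show False
  proof (cases "c' = d")
    case True
    then show ?thesis using h i d by (auto simp: e_at_def split: if_splits)
  next
    case False
    then have "c' < d" using assms d by simp
    have e': "Suc i \<in> T (r, Suc d)" using assms d by (simp add: e_box_def)
    have "(r, d) \<in> diagram lam"
      using diagram_mono[OF entry_in_diagram[OF e']] by simp
    then obtain z where z: "z \<in> T (r, d)" using nonempty by blast
    have "Suc i \<le> z" using row_le[OF i z] \<open>c' < d\<close> by blast
    moreover have "z \<le> Suc i" using row_le[OF z e'] by simp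
    ultimately have "Suc i \<in> T (r, d)" using z by simp
    from e_box_left[OF assms(1)[unfolded d] this] show False
      using row_le[OF i] \<open>c' < d\<close> by fastforce
  qed
qed

lemma e_at_SVT:
  assumes e: "e_box i T r c" and i: "0 < i" "i < n"
  shows "e_at i r c T \<in> SVT n lam"
  unfolding SVT_iff
proof (intro conjI allI impI ballI; (elim conjE)?)
  have rc: "Suc i \<in> T (r, c)" and ni: "\<And>r'. i \<notin> T (r', c)"
    using e by (auto simp: e_box_def in_column_def)
  fix b assume b: "b \<in> diagram lam"
  show "e_at i r c T b \<noteq> {}"
  proof (cases c)
    case 0
    then show ?thesis using nonempty[OF b] by (auto simp: e_at_def)
  next
    case (Suc d)
    then show ?thesis using nonempty[OF b] e_box_left[of i r d] e by (auto simp: e_at_def)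
  qed
  show "e_at i r c T b \<subseteq> {1..n}"
    using e_at_cases[OF e, of _ "fst b" "snd b"] entry_range[of _ b] i
    by (fastforce simp: Suc_le_eq)
next
  fix b assume "b \<notin> diagram lam"
  moreover have "b \<noteq> (r, c)"
    using calculation entry_in_diagram e by (auto simp: e_box_def)
  ultimately show "e_at i r c T b = {}"
    using e_at_cases[OF e, of _ "fst b" "snd b"] entry_in_diagram[of _ b]
    by (cases b) auto
next
  fix r' a b x y
  assume h: "x \<in> e_at i r c T (r', a)" "y \<in> e_at i r c T (r', b)" "a < b"
  from e_at_cases[OF e h(1)] e_at_cases[OF e h(2)] show "x \<le> y"
  proof (elim disjE conjE)
    assume "x = i" "r' = r" "a = c" "y \<in> T (r', b)"
    then show ?thesis using row_le[of "Suc i" r c y b] h e by (simp add: e_box_def)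
  next
    assume "x \<in> T (r', a)" "y = i" "r' = r" "b = c"
    then show ?thesis using row_le[of x r a "Suc i" c] h e e_at_left[OF e, of a]
      by (metis e_box_def le_SucE)
  qed (use h row_le in auto)
next
  fix r1 r2 c' x y
  assume h: "x \<in> e_at i r c T (r1, c')" "y \<in> e_at i r c T (r2, c')" "r1 < r2"
  from e_at_cases[OF e h(1)] e_at_cases[OF e h(2)] show "x < y"
  proof (elim disjE conjE)
    assume "x = i" "r1 = r" "c' = c" "y \<in> T (r2, c')"
    then show ?thesis using column_less[of "Suc i" r c y r2] h e by (simp add: e_box_def)
  next
    assume "x \<in> T (r1, c')" "y = i" "r2 = r" "c' = c"
    then show ?thesis using column_less[of x r1 c "Suc i" r] h e
      by (metis less_SucE e_box_def in_column_def)
  qed (use h column_less in auto)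
qed

text \<open>Two marked columns suffice, since an operator changes \<open>column_diff\<close> in its
  own column and at most one neighbour. A change in a single column is the case
  \<open>d = c\<close>, \<open>l = 0\<close>.\<close>

lemma height_change:
  assumes "\<And>c'. column_diff i T' c' = column_diff i T c' + (if c' = c then k else 0) + (if c' = d then l else 0)"
  shows "height i T' c' = height i T c' + (if c < c' then k else 0) + (if d < c' then l else 0)"
  by (induction c') (auto simp: columns_diff_last assms)

text \<open>If \<open>e_i\<close> replaces an entry, the peak step stays in column \<open>c\<close>
  and turns from down to up. If it takes \<open>Suc i\<close> from the left box, column
  \<open>c\<close> ends with both entries and column \<open>c - 1\<close> with \<open>i\<close>
  only, so \<open>f_i\<close> then acts one column further left.\<close>

lemma f_of_e_at:
  assumes e: "e_box i T r c" and i: "0 < i" "i < n"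
  shows "svt_f lam i (e_at i r c T) = Some T"
proof -
  let ?T' = "e_at i r c T"
  interpret T': svt n lam ?T'
    using lam e_at_SVT[OF e i] by unfold_locales
  have rc: "Suc i \<in> T (r, c)" and ni: "\<And>r'. i \<notin> T (r', c)"
    using e by (auto simp: e_box_def in_column_def)
  have only: "r' = r" if "Suc i \<in> T (r', c)" for r' using column_unique[OF that rc] .
  have nr: "i \<notin> T (r, c')" if "c < c'" for c' using row_le[OF rc _ that, of i] by auto
  show ?thesis
  proof (cases "c = 0 \<or> i + 1 \<notin> T (r, c - 1)")
    case True
    then have T': "?T' = T((r, c) := insert i (T (r, c) - {i + 1}))" by (simp add: e_at_def)
    have "Suc i \<notin> ?T' (r', c)" for r'
      using only[of r'] by (cases "r' = r") (auto simp: T')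
    then have col: "in_column i c ?T'" "\<not> in_column (Suc i) c ?T'" "\<not> in_column i c T" "in_column (Suc i) c T"
      using rc ni by (auto simp: in_column_def T')
    have "in_column j c' ?T' = in_column j c' T" if "c' \<noteq> c" for j c'
      using that by (auto simp: T' in_column_def)
    \<comment> \<open>Column \<open>c\<close> turns from - to +, a change of 2.\<close>
    then have "column_diff i ?T' c' = column_diff i T c' + (if c' = c then 2 else 0) + (if c' = c then 0 else 0)" for c'
      using col by (auto simp: column_diff_def)
    note H = height_change[OF this]
    have "peak_step i ?T' c"
      using e unfolding peak_step_def H e_box_def by simp
    then have "f_box i ?T' r c"
      using col by (simp add: f_box_def T')
    moreover have "f_at i r c ?T' = T"
      using nr[of "Suc c"] rc ni by (auto simp: f_at_def T' fun_eq_iff)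
    ultimately show ?thesis using T'.svt_f_eq by fastforce
  next
    case False
    then obtain d where d: "c = Suc d" and sd: "Suc i \<in> T (r, d)" by (cases c) auto
    have id: "i \<in> T (r, d)" by (rule e_box_left) (use e d sd in auto)
    have T': "?T' = T((r, d) := T (r, d) - {i + 1}, (r, c) := insert i (T (r, c)))"
      using False d by (simp add: e_at_def)
    have "i \<in> ?T' (r, c)" "Suc i \<in> ?T' (r, c)" using rc d unfolding T' by simp_all
    then have col: "in_column i c ?T'" "in_column (Suc i) c ?T'" "\<not> in_column i c T" "in_column (Suc i) c T"
      using rc ni unfolding in_column_def by blast+
    have "Suc i \<notin> ?T' (r', d)" for r'
      using column_unique[OF sd, of r'] d unfolding T' by (cases "r' = r") auto
    moreover have id': "i \<in> ?T' (r, d)" using id d unfolding T' by simp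
    ultimately have col': "in_column i d ?T'" "\<not> in_column (Suc i) d ?T'" "in_column i d T" "in_column (Suc i) d T"
      using id sd unfolding in_column_def by blast+
    have "in_column j c' ?T' = in_column j c' T" if "c' \<noteq> c" "c' \<noteq> d" for j c'
      using that by (auto simp: T' in_column_def)
    then have "column_diff i ?T' c' = column_diff i T c' + (if c' = c then 1 else 0) + (if c' = d then 1 else 0)" for c'
      using col col' d by (auto simp: column_diff_def)
    note H = height_change[OF this]
    have Hc: "height i T (Suc d) = height i T d"
      using col' by (simp add: columns_diff_last column_diff_def)
    have Hc': "height i T (Suc c) = height i T c - 1" by (rule e_box_height[OF e])
    \<comment> \<open>With \<open>M\<close> the old maximum, the heights up to \<open>d\<close> are
      at most \<open>M\<close>, a value attained at \<open>d\<close>; the new height at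
      \<open>Suc d\<close> is \<open>M + 1\<close>. Beyond \<open>c\<close> the old heights are at
      most \<open>M - 1\<close> and grow by 2.\<close>
    have "peak_step i ?T' d"
      unfolding peak_step_def H
    proof (intro conjI allI impI)
      fix c' assume "c' \<le> d"
      then show "height i T c' + (if c < c' then 1 else 0) + (if d < c' then 1 else 0)
          \<le> height i T d + (if c < d then 1 else 0) + (if d < d then 1 else 0)"
        using e Hc d by (auto simp: e_box_def peak_step_def)
    next
      fix c' assume "d < c'"
      then have "c' = c \<or> c < c'" using d by auto
      then show "height i T c' + (if c < c' then 1 else 0) + (if d < c' then 1 else 0)
          \<le> height i T (Suc d) + (if c < Suc d then 1 else 0) + (if d < Suc d then 1 else 0)"
        using e Hc' d by (auto simp: e_box_def peak_step_def)
    qed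
    then have "f_box i ?T' r d" using id' col' by (simp add: f_box_def)
    moreover have "f_at i r d ?T' = T"
      using d sd ni unfolding T' f_at_def by (auto simp: fun_eq_iff)
    ultimately show ?thesis using T'.svt_f_eq by fastforce
  qed
qed

end

section \<open>Reading words\<close>

definition word_diff :: "nat \<Rightarrow> nat list \<Rightarrow> int" where
  "word_diff i w = int (count_list w i) - int (count_list w (Suc i))"

lemma word_diff_simps [simp]:
  "word_diff i [] = 0"
  "word_diff i (x # w) = of_bool (x = i) - of_bool (x = Suc i) + word_diff i w"
  "word_diff i (u @ v) = word_diff i u + word_diff i v"
  by (simp_all add: word_diff_def)

lemma word_diff_le_wphi: "word_diff i w \<le> int (wphi i w)"
  by (induction w) auto

text \<open>\<open>wphi i\<close> is the maximum of \<open>word_diff i\<close> over all prefixes,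
  the empty one included.\<close>

lemma wphi_append: "int (wphi i (u @ v)) = max (int (wphi i u)) (word_diff i u + int (wphi i v))"
proof (induction u)
  case (Cons x u)
  then show ?case using word_diff_le_wphi[of i u] by (auto simp: max_def split: if_splits)
qed simp

lemma wphi_eq_0: "i \<notin> set w \<Longrightarrow> wphi i w = 0"
  by (induction w) auto

lemma wphi_eq_count: "Suc i \<notin> set w \<Longrightarrow> wphi i w = count_list w i"
  by (induction w) auto

lemma wphi_sorted: "sorted w \<Longrightarrow> wphi i w = count_list w i"
proof (induction w)
  case (Cons x w)
  have "count_list w i = 0" if "x = Suc i"
    using Cons.prems that by (auto simp: count_list_0_iff)
  then show ?case using Cons by auto
qed simp

text \<open>The changed letter is the one at which the prefix sums first reach their maximum:
  \<open>u\<close> ends at its own maximum, \<open>i\<close> goes one above it, and \<open>v\<close>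
  never climbs higher.\<close>

lemma word_f_append:
  assumes "int (wphi i u) = word_diff i u" "wphi i v = 0"
  shows "word_f i (u @ i # v) = Some (u @ Suc i # v)"
  using assms(1)
proof (induction u)
  case Nil
  then show ?case using assms(2) by simp
next
  case (Cons x u)
  have IH: "int (wphi i u) = word_diff i u"
    using Cons.prems word_diff_le_wphi[of i u] by (auto split: if_splits)
  moreover have "wphi i (u @ i # v) = Suc (wphi i u)"
    using wphi_append[of i u "i # v"] IH assms(2) by simp
  ultimately show ?case using Cons by (auto split: if_splits)
qed

text \<open>The total is the number of surviving + minus the number of surviving -, so equality
  leaves no -.\<close>

lemma word_e_None: "int (wphi i w) = word_diff i w \<Longrightarrow> word_e i w = None"
proof (induction w)
  case (Cons x w)
  then show ?case using word_diff_le_wphi[of i w] by (auto split: if_splits)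
qed simp

text \<open>No element of a row is non-minimal in two boxes, so the set of these elements loses nothing.\<close>

definition extras :: "filling \<Rightarrow> nat \<Rightarrow> nat set" where
  "extras T r = {v. \<exists>c u. v \<in> T (r, c) \<and> u \<in> T (r, c) \<and> u < v}"

definition decreasing_word :: "nat \<Rightarrow> nat set \<Rightarrow> nat list" where
  "decreasing_word n X = filter (\<lambda>v. v \<in> X) (rev [1..<Suc n])"

definition row_minima :: "nat list \<Rightarrow> filling \<Rightarrow> nat \<Rightarrow> nat list" where
  "row_minima lam T r = map (\<lambda>c. Min (T (r, c))) [0..<lam ! r]"

definition row_word :: "nat \<Rightarrow> nat list \<Rightarrow> filling \<Rightarrow> nat \<Rightarrow> nat list" where
  "row_word n lam T r = decreasing_word n (extras T r) @ row_minima lam T r"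

definition rows_word :: "nat \<Rightarrow> nat list \<Rightarrow> filling \<Rightarrow> nat \<Rightarrow> nat \<Rightarrow> nat list" where
  "rows_word n lam T a b = concat (map (row_word n lam T) (rev [a..<b]))"

definition reading_word :: "nat \<Rightarrow> nat list \<Rightarrow> filling \<Rightarrow> nat list" where
  "reading_word n lam T = rows_word n lam T 0 (length lam)"

lemma rows_word_same [simp]: "rows_word n lam T a a = []"
  by (simp add: rows_word_def)

lemma rows_word_first:
  "a < b \<Longrightarrow> rows_word n lam T a b = rows_word n lam T (Suc a) b @ row_word n lam T a"
  by (simp add: rows_word_def upt_conv_Cons)

lemma rows_word_append:
  "a \<le> b \<Longrightarrow> b \<le> c \<Longrightarrow> rows_word n lam T a c = rows_word n lam T b c @ rows_word n lam T a b"
  using upt_add_eq_append[of a b "c - b"] by (simp add: rows_word_def)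

lemma rows_word_cong:
  "(\<And>r. a \<le> r \<Longrightarrow> r < b \<Longrightarrow> row_word n lam T r = row_word n lam T' r) \<Longrightarrow>
    rows_word n lam T a b = rows_word n lam T' a b"
  by (auto simp: rows_word_def intro!: arg_cong[of _ _ concat])

lemma set_decreasing_word: "set (decreasing_word n X) = {1..n} \<inter> X"
  by (auto simp: decreasing_word_def)

lemma distinct_decreasing_word: "distinct (decreasing_word n X)"
  by (simp add: decreasing_word_def)

lemma decreasing_word_split:
  assumes "0 < i" "i < n"
  shows "decreasing_word n X = filter (\<lambda>v. v \<in> X) (rev [Suc (Suc i)..<Suc n]) @
    filter (\<lambda>v. v \<in> X) [Suc i, i] @ filter (\<lambda>v. v \<in> X) (rev [1..<i])"
proof -
  have "[1..<Suc n] = [1..<i] @ [i..<Suc n]"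
    using upt_add_eq_append[of 1 i "Suc n - i"] assms by simp
  also have "[i..<Suc n] = i # Suc i # [Suc (Suc i)..<Suc n]"
    using assms by (simp add: upt_conv_Cons)
  finally show ?thesis by (simp add: decreasing_word_def)
qed

lemma count_list_distinct: "distinct xs \<Longrightarrow> count_list xs x = of_bool (x \<in> set xs)"
  by (induction xs) auto

lemma count_decreasing_word: "count_list (decreasing_word n X) j = of_bool (j \<in> {1..n} \<inter> X)"
  by (simp add: count_list_distinct distinct_decreasing_word set_decreasing_word)

context svt
begin

lemma finite_box: "finite (T b)"
  using entry_range[of _ b] by (intro finite_subset[of "T b" "{1..n}"]) (meson atLeastAtMost_iff subsetI, simp)

lemma Min_box: "b \<in> diagram lam \<Longrightarrow> Min (T b) \<in> T b"
  using nonempty finite_box by (metis Min_in empty_iff)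

lemma Min_box_le: "x \<in> T b \<Longrightarrow> Min (T b) \<le> x"
  using finite_box by simp

lemma diagram_row: "r < length lam \<Longrightarrow> c < lam ! r \<Longrightarrow> (r, c) \<in> diagram lam"
  by (simp add: diagram_def)

lemma entry_row: "x \<in> T (r, c) \<Longrightarrow> r < length lam \<and> c < lam ! r"
  using entry_in_diagram by (force simp: diagram_def)

lemma extras_range: "extras T r \<subseteq> {1..n}"
  using entry_range by (force simp: extras_def)

lemma extras_iff_Min: "v \<in> extras T r \<longleftrightarrow> (\<exists>c. v \<in> T (r, c) \<and> v \<noteq> Min (T (r, c)))"
proof
  assume "v \<in> extras T r"
  then obtain c u where "v \<in> T (r, c)" "u \<in> T (r, c)" "u < v" by (auto simp: extras_def)
  then show "\<exists>c. v \<in> T (r, c) \<and> v \<noteq> Min (T (r, c))" using Min_box_le[of u "(r, c)"] by auto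
next
  assume "\<exists>c. v \<in> T (r, c) \<and> v \<noteq> Min (T (r, c))"
  then obtain c where c: "v \<in> T (r, c)" "v \<noteq> Min (T (r, c))" by blast
  then have "Min (T (r, c)) \<in> T (r, c)" "Min (T (r, c)) < v"
    using Min_box entry_in_diagram Min_box_le by (blast, metis le_neq_implies_less)
  then show "v \<in> extras T r" using c by (auto simp: extras_def)
qed

lemma sorted_row_minima: "r < length lam \<Longrightarrow> sorted (row_minima lam T r)"
  unfolding row_minima_def sorted_iff_nth_mono_less
proof (intro allI impI)
  fix c c' assume h: "r < length lam" "c < c'" "c' < length (map (\<lambda>c. Min (T (r, c))) [0..<lam ! r])"
  have "Min (T (r, c)) \<le> Min (T (r, c'))"
    by (rule row_le[OF Min_box Min_box \<open>c < c'\<close>]) (use h diagram_row in auto)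
  then show "map (\<lambda>c. Min (T (r, c))) [0..<lam ! r] ! c \<le> map (\<lambda>c. Min (T (r, c))) [0..<lam ! r] ! c'"
    using h by simp
qed

lemma count_row_word:
  assumes "r < length lam" "0 < j"  "j \<le> n"
  shows "count_list (row_word n lam T r) j = card {c. j \<in> T (r, c)}"
proof -
  have "count_list (map f [0..<m]) j = card {c. c < m \<and> f c = j}" for f :: "nat \<Rightarrow> nat" and m
  proof (induction m)
    case (Suc m)
    have "{c. c < Suc m \<and> f c = j} = {c. c < m \<and> f c = j} \<union> (if f m = j then {m} else {})"
      by (auto simp: less_Suc_eq)
    then show ?case using Suc by simp
  qed simp
  then have mins: "count_list (row_minima lam T r) j = card {c. c < lam ! r \<and> Min (T (r, c)) = j}"
    by (simp add: row_minima_def)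
  define A where "A = {c. c < lam ! r \<and> Min (T (r, c)) = j}"
  define B where "B = {c. j \<in> T (r, c) \<and> Min (T (r, c)) \<noteq> j}"
  have "c < lam ! r" if "j \<in> T (r, c)" for c using entry_row[OF that] by simp
  moreover have "Min (T (r, c)) \<in> T (r, c)" if "c < lam ! r" for c
    using Min_box diagram_row[OF assms(1) that] .
  ultimately have AB: "{c. j \<in> T (r, c)} = A \<union> B"
    unfolding A_def B_def by blast
  have fin: "finite {c. j \<in> T (r, c)}"
    by (rule finite_subset[of _ "{..<lam ! r}"]) (use entry_row in auto)
  \<comment> \<open>Of two boxes with \<open>j\<close>, the right one has all its entries at least
    \<open>j\<close>, so \<open>j\<close> is its minimum; hence \<open>j\<close> is non-minimal at
    most once in the row.\<close>
  have "card B = of_bool (j \<in> extras T r)"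
  proof (cases "j \<in> extras T r")
    case True
    then obtain c where c: "c \<in> B" by (auto simp: extras_iff_Min B_def)
    have "c1 = c2" if "c1 \<in> B" "c2 \<in> B" for c1 c2
    proof -
      have "\<not> c1 < c2" if "c1 \<in> B" "c2 \<in> B" for c1 c2
      proof
        assume "c1 < c2"
        have j2: "j \<in> T (r, c2)" "Min (T (r, c2)) \<noteq> j" using that by (auto simp: B_def)
        have "j \<le> Min (T (r, c2))"
          using row_le[of j r c1 "Min (T (r, c2))" c2] Min_box[OF entry_in_diagram[OF j2(1)]] that(1) \<open>c1 < c2\<close>
          by (simp add: B_def)
        then show False using Min_box_le[OF j2(1)] j2(2) by simp
      qed
      then show ?thesis using that by (meson linorder_neqE_nat)
    qed
    then have "B = {c}" using c by blast
    then show ?thesis using True by simp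
  next
    case False
    then have "B = {}" by (auto simp: extras_iff_Min B_def)
    then show ?thesis using False by simp
  qed
  moreover have "card (A \<union> B) = card A + card B"
    by (rule card_Un_disjoint) (use fin AB in \<open>auto simp: A_def B_def\<close>)
  ultimately show ?thesis using assms mins extras_range
    by (simp add: row_word_def count_decreasing_word AB A_def)
qed

text \<open>An extra \<open>Suc i\<close> precedes every \<open>i\<close> of the row word, and a
  minimal \<open>Suc i\<close> follows every \<open>i\<close>. So the prefix sum is largest either
  at the start or after the last \<open>i\<close>.\<close>

lemma wphi_row_word:
  assumes "r < length lam" "0 < i" "i < n"
  shows "int (wphi i (row_word n lam T r)) =
    max 0 (int (count_list (row_word n lam T r) i) - of_bool (Suc i \<in> extras T r))"
proof -
  let ?X = "extras T r"
  define hi where "hi = filter (\<lambda>v. v \<in> ?X) (rev [Suc (Suc i)..<Suc n]) @ filter (\<lambda>v. v \<in> ?X) [Suc i]"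
  define lo where "lo = filter (\<lambda>v. v \<in> ?X) [i] @ filter (\<lambda>v. v \<in> ?X) (rev [1..<i])"
  have ex: "decreasing_word n ?X = hi @ lo"
    by (simp add: decreasing_word_split[OF assms(2,3)] hi_def lo_def)
  have hi: "i \<notin> set hi" and lo: "Suc i \<notin> set lo" by (auto simp: hi_def lo_def)
  have dlo: "word_diff i lo = int (count_list lo i)"
    using lo by (simp add: word_diff_def count_list_0_iff)
  have "count_list hi (Suc i) = of_bool (Suc i \<in> ?X)"
    using count_decreasing_word[of n ?X "Suc i"] lo assms by (simp add: ex count_list_0_iff)
  moreover have "count_list hi i = 0" using hi by (simp add: count_list_0_iff)
  ultimately have dhi: "word_diff i hi = - of_bool (Suc i \<in> ?X)" "count_list hi i = 0"
    by (simp_all add: word_diff_def)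
  show ?thesis
    using wphi_append[of i lo "row_minima lam T r"] wphi_append[of i hi "lo @ row_minima lam T r"]
    by (simp add: row_word_def ex wphi_eq_0[OF hi] wphi_eq_count[OF lo] dlo dhi
        wphi_sorted[OF sorted_row_minima[OF assms(1)]])
qed

section \<open>Prefix sums of the reading word compared with heights\<close>

lemma card_columns:
  assumes "finite R"
  shows "card (\<Union>r\<in>R. {c. j \<in> T (r, c)}) = (\<Sum>r\<in>R. card {c. j \<in> T (r, c)})"
proof (rule card_UN_disjoint)
  have "{c. j \<in> T (r, c)} \<subseteq> {..<lam ! r}" for r using entry_row by blast
  then show "\<forall>r\<in>R. finite {c. j \<in> T (r, c)}" using finite_subset finite_lessThan by blast
  show "\<forall>r\<in>R. \<forall>r'\<in>R. r \<noteq> r' \<longrightarrow> {c. j \<in> T (r, c)} \<inter> {c. j \<in> T (r', c)} = {}"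
    using column_unique by blast
qed (rule assms)

lemma height_eq_card:
  "height i T k = int (card {c. c < k \<and> in_column i c T}) - int (card {c. c < k \<and> in_column (Suc i) c T})"
proof (induction k)
  case (Suc k)
  have "{c. c < Suc k \<and> in_column j c T} =
      {c. c < k \<and> in_column j c T} \<union> (if in_column j k T then {k} else {})" for j
    by (auto simp: less_Suc_eq)
  then show ?case using Suc by (simp add: columns_diff_last column_diff_def)
qed simp

lemma count_rows_word:
  assumes "0 < j" "j \<le> n" "b \<le> length lam"
  shows "count_list (rows_word n lam T a b) j = (\<Sum>r\<in>{a..<b}. card {c. j \<in> T (r, c)})"
proof (cases "a \<le> b")
  case True
  then show ?thesis
  proof (induction rule: inc_induct)
    case (step a)
    then show ?case using count_row_word[of a j] assms
      by (simp add: rows_word_first sum.atLeast_Suc_lessThan)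
  qed simp
qed (simp add: rows_word_def)

lemma right_of_last:
  assumes q: "i \<in> T (r, q)" "i \<notin> T (r, Suc q)" and "q < c" "y \<in> T (r, c)"
  shows "i < y"
proof -
  have "i \<le> y" using row_le[OF q(1) assms(4,3)] .
  moreover have "y \<noteq> i"
  proof
    assume "y = i"
    then have "Suc q < c" using assms by (metis Suc_lessI)
    have "(r, Suc q) \<in> diagram lam"
      using diagram_mono[OF entry_in_diagram[OF assms(4)]] \<open>q < c\<close> by simp
    then obtain z where z: "z \<in> T (r, Suc q)" using nonempty by blast
    have "i \<le> z" using row_le[OF q(1) z] by simp
    moreover have "z \<le> i" using row_le[OF z assms(4) \<open>Suc q < c\<close>] \<open>y = i\<close> by simp
    ultimately show False using z q(2) by (metis le_antisym)
  qed
  ultimately show ?thesis by simp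
qed

lemma extras_Suc_iff:
  assumes "i \<in> T (r, q)" "i \<notin> T (r, Suc q)"
  shows "Suc i \<in> extras T r \<longleftrightarrow> Suc i \<in> T (r, q)"
proof
  assume "Suc i \<in> extras T r"
  then obtain c u where c: "Suc i \<in> T (r, c)" "u \<in> T (r, c)" "u < Suc i" by (auto simp: extras_def)
  have "\<not> c < q" using row_le[OF c(1) assms(1)] by auto
  moreover have "\<not> q < c" using right_of_last[OF assms _ c(2)] c(3) by auto
  ultimately show "Suc i \<in> T (r, q)" using c by (metis linorder_neqE_nat)
qed (use assms in \<open>auto simp: extras_def\<close>)

text \<open>Among the columns up to \<open>q\<close>, the \<open>i\<close> are exactly those in row
  \<open>r\<close> and below. The \<open>Suc i\<close> are exactly those in the rows below
  \<open>r\<close>, and possibly one in box \<open>(r, q)\<close>, where it is an extra. The word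
  has read the same numbers of both after the last \<open>i\<close> of row \<open>r\<close>.\<close>

lemma height_row:
  assumes i: "0 < i" "i < n" and q: "i \<in> T (r, q)" "i \<notin> T (r, Suc q)"
  shows "height i T (Suc q) = word_diff i (rows_word n lam T (Suc r) (length lam)) +
    int (count_list (row_word n lam T r) i) - of_bool (Suc i \<in> extras T r)"
proof -
  let ?L = "length lam"
  have rL: "r < ?L" using entry_row[OF q(1)] by simp
  have "r \<le> r'" if c: "c \<le> q" "i \<in> T (r', c)" for c r'
  proof (rule ccontr)
    assume "\<not> r \<le> r'"
    then have "r' < r" by simp
    have "(r', q) \<in> diagram lam"
      using diagram_mono[OF entry_in_diagram[OF q(1)]] \<open>r' < r\<close> by simp
    then obtain y where y: "y \<in> T (r', q)" using nonempty by blast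
    have "y < i" using column_less[OF y q(1) \<open>r' < r\<close>] .
    moreover have "i \<le> y" if "c < q" using row_le[OF c(2) y that] .
    moreover have "c \<noteq> q" using column_unique[OF q(1)] c(2) \<open>r' < r\<close> by auto
    ultimately show False using c(1) by simp
  qed
  \<comment> \<open>To the right of \<open>q\<close> all entries of row \<open>r\<close> exceed
    \<open>i\<close>, hence those of lower rows exceed \<open>Suc i\<close>.\<close>
  moreover have left: "c \<le> q" if c: "x \<in> T (r', c)" "r \<le> r'" "x \<le> Suc i" "r = r' \<longrightarrow> x = i" for c r' x
  proof (rule ccontr)
    assume "\<not> c \<le> q"
    then have "q < c" by simp
    have "(r, c) \<in> diagram lam"
      using diagram_mono[OF entry_in_diagram[OF c(1)]] c(2) by simp
    then obtain y where y: "y \<in> T (r, c)" using nonempty by blast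
    have "i < y" using right_of_last[OF q \<open>q < c\<close> y] .
    moreover have "y < x" if "r \<noteq> r'" using column_less[OF y c(1)] that c(2) by simp
    moreover have "i < x" if "r = r'" using right_of_last[OF q \<open>q < c\<close>] that c(1) by simp
    ultimately show False using c(3,4) by (cases "r = r'") auto
  qed
  moreover have "r' < ?L" if "x \<in> T (r', c)" for x r' c using entry_row[OF that] by simp
  ultimately have "{c. c < Suc q \<and> in_column i c T} = (\<Union>r'\<in>{r..<?L}. {c. i \<in> T (r', c)})"
    by (fastforce simp: in_column_def less_Suc_eq_le)
  then have card_i: "card {c. c < Suc q \<and> in_column i c T} = (\<Sum>r'\<in>{r..<?L}. card {c. i \<in> T (r', c)})"
    using card_columns by simp
  have above: "r < r' \<or> r' = r \<and> c = q" if c: "c \<le> q" "Suc i \<in> T (r', c)" for c r'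
  proof (rule ccontr)
    assume n: "\<not> (r < r' \<or> r' = r \<and> c = q)"
    have "(r, c) \<in> diagram lam"
      using diagram_mono[OF entry_in_diagram[OF q(1)]] c(1) by simp
    then obtain y where y: "y \<in> T (r, c)" using nonempty by blast
    have "Suc i < y" if "r' < r" using column_less[OF c(2) y that] .
    moreover have "y \<le> i" if "c < q" using row_le[OF y q(1) that] .
    moreover have "Suc i \<le> i" if "r' = r" "c < q" using row_le[OF _ q(1) that(2)] c(2) that(1) by blast
    moreover have "Suc i < i" if "r' < r" "c = q" using column_less[OF _ q(1) that(1)] c(2) that(2) by blast
    ultimately show False using n c(1) by (metis Suc_n_not_le_n le_neq_implies_less less_imp_le
        linorder_neqE_nat not_less order.strict_trans2)
  qed
  let ?U = "\<Union>r'\<in>{Suc r..<?L}. {c. Suc i \<in> T (r', c)}"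
  let ?Q = "if Suc i \<in> T (r, q) then {q} else {}"
  have "{c. c < Suc q \<and> in_column (Suc i) c T} = ?U \<union> ?Q"
  proof (intro equalityI subsetI)
    fix c assume "c \<in> {c. c < Suc q \<and> in_column (Suc i) c T}"
    then obtain r' where "c \<le> q" "Suc i \<in> T (r', c)" by (auto simp: in_column_def)
    then show "c \<in> ?U \<union> ?Q" using above[of c r'] entry_row[of "Suc i" r' c] by auto
  next
    fix c assume "c \<in> ?U \<union> ?Q"
    then show "c \<in> {c. c < Suc q \<and> in_column (Suc i) c T}"
      using left[of "Suc i"] by (fastforce simp: in_column_def less_Suc_eq_le split: if_splits)
  qed
  moreover have "?U \<inter> ?Q = {}" using column_unique[of "Suc i" r q] by auto
  moreover have "finite {c. c < Suc q \<and> in_column (Suc i) c T}" by simp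
  ultimately have card_Suc: "card {c. c < Suc q \<and> in_column (Suc i) c T} =
      (\<Sum>r'\<in>{Suc r..<?L}. card {c. Suc i \<in> T (r', c)}) + of_bool (Suc i \<in> T (r, q))"
    using card_columns[of "{Suc r..<?L}" "Suc i"] by (simp add: card_Un_disjoint)
  show ?thesis
    using rL i count_rows_word[of i ?L "Suc r"] count_rows_word[of "Suc i" ?L "Suc r"]
      count_row_word[OF rL, of i] extras_Suc_iff[OF q]
    by (simp add: height_eq_card card_i card_Suc word_diff_def sum.atLeast_Suc_lessThan)
qed

end

text \<open>The prefix sums never rise along \<open>u\<close> and never fall along \<open>v\<close>,
  so the maximum is attained at one of the two ends.\<close>

lemma wphi_two_parts:
  assumes "i \<notin> set u" "Suc i \<notin> set v"
  shows "int (wphi i (u @ v)) = max 0 (word_diff i (u @ v))"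
  using wphi_append[of i u v] wphi_eq_0[OF assms(1)] wphi_eq_count[OF assms(2)] assms(2)
  by (simp add: word_diff_def count_list_0_iff)

context svt
begin

lemma last_column:
  assumes "i \<in> T (r, c)"
  obtains q where "i \<in> T (r, q)" "i \<notin> T (r, Suc q)"
proof -
  have fin: "finite {c. i \<in> T (r, c)}"
    by (rule finite_subset[of _ "{..<lam ! r}"]) (use entry_row in auto)
  show ?thesis
    using that[of "Max {c. i \<in> T (r, c)}"] Max_in[OF fin] Max_ge[OF fin, of "Suc (Max {c. i \<in> T (r, c)})"] assms
    by fastforce
qed

text \<open>By \<open>wphi_row_word\<close> a row can raise the maximum only after its last
  \<open>i\<close>, and there the prefix sum is a height by \<open>height_row\<close>. The
  assumption \<open>start\<close> covers the empty prefix of the range.\<close>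

lemma rows_bound:
  assumes i: "0 < i" "i < n" and "a \<le> b" "b \<le> length lam"
    and start: "word_diff i (rows_word n lam T b (length lam)) \<le> M"
    and M: "\<And>r q. a \<le> r \<Longrightarrow> r < b \<Longrightarrow> i \<in> T (r, q) \<Longrightarrow> i \<notin> T (r, Suc q) \<Longrightarrow> height i T (Suc q) \<le> M"
  shows "word_diff i (rows_word n lam T b (length lam)) + int (wphi i (rows_word n lam T a b)) \<le> M"
  using assms(3) M
proof (induction rule: inc_induct)
  case base
  then show ?case using start by simp
next
  case (step a)
  let ?L = "length lam" and ?W = "rows_word n lam T"
  have aL: "a < ?L" using step.hyps assms(4) by simp
  have IH: "word_diff i (?W b ?L) + int (wphi i (?W (Suc a) b)) \<le> M"
    by (intro step.IH step.prems) auto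
  have split: "?W (Suc a) ?L = ?W b ?L @ ?W (Suc a) b"
    by (rule rows_word_append) (use step.hyps assms(4) in auto)
  have "word_diff i (?W (Suc a) ?L) + int (wphi i (row_word n lam T a)) \<le> M"
  proof (cases "count_list (row_word n lam T a) i = 0")
    case True
    then have "wphi i (row_word n lam T a) = 0" by (simp add: wphi_eq_0 count_list_0_iff)
    then show ?thesis using IH word_diff_le_wphi[of i "?W (Suc a) b"] by (simp add: split)
  next
    case False
    then have "{c. i \<in> T (a, c)} \<noteq> {}" using count_row_word[OF aL, of i] i by (metis card.empty nat_less_le)
    then obtain c where "i \<in> T (a, c)" by blast
    then obtain q where q: "i \<in> T (a, q)" "i \<notin> T (a, Suc q)" by (rule last_column)
    then have "height i T (Suc q) \<le> M" using step.prems[of a q] step.hyps by simp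
    then show ?thesis using height_row[OF i q] wphi_row_word[OF aL i] False by simp
  qed
  then show ?case
    using IH wphi_append[of i "?W (Suc a) b" "row_word n lam T a"] step.hyps
    by (simp add: rows_word_first split)
qed

section \<open>The effect of \<open>f_i\<close> on the word of its row\<close>

lemma Min_right_of:
  assumes "x \<in> T (r, c)" "c < c'" "(r, c') \<in> diagram lam"
  shows "x \<le> Min (T (r, c'))"
  using row_le[OF assms(1) Min_box[OF assms(3)] assms(2)] .

lemma Min_left_of:
  assumes "x \<in> T (r, c)" "c' < c"
  shows "Min (T (r, c')) \<le> x"
proof -
  have "(r, c') \<in> diagram lam" using diagram_mono[OF entry_in_diagram[OF assms(1)]] assms(2) by simp
  then show ?thesis using row_le[OF Min_box assms] by simp
qed

text \<open>\<open>T'\<close> enters only through its minima and extras because two forms of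
  \<open>f_i\<close> lead here: replacing a minimal \<open>i\<close>, and taking \<open>i\<close>
  from the box on the right. In both, the changed letter is the minimum of the last box of the row
  that contains \<open>i\<close>.\<close>

lemma row_word_split_Min:
  assumes i: "0 < i" "i < n" and q: "i \<in> T (r, q)" "i \<notin> T (r, Suc q)" "Min (T (r, q)) = i"
    and T': "Min (T' (r, q)) = Suc i" "\<And>c. c \<noteq> q \<Longrightarrow> Min (T' (r, c)) = Min (T (r, c))"
      "extras T' r = extras T r"
  obtains u v where "row_word n lam T r = u @ i # v" "row_word n lam T' r = u @ Suc i # v"
    "i \<notin> set v" "int (wphi i u) = max 0 (word_diff i u)"
    "count_list u (Suc i) = of_bool (Suc i \<in> extras T r)"
proof -
  let ?X = "extras T r"
  have rq: "r < length lam" "q < lam ! r" using entry_row[OF q(1)] by auto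
  define hi where "hi = filter (\<lambda>v. v \<in> ?X) (rev [Suc (Suc i)..<Suc n]) @ filter (\<lambda>v. v \<in> ?X) [Suc i]"
  define lo where "lo = filter (\<lambda>v. v \<in> ?X) [i] @ filter (\<lambda>v. v \<in> ?X) (rev [1..<i])"
  define m1 where "m1 = map (\<lambda>c. Min (T (r, c))) [0..<q]"
  define m2 where "m2 = map (\<lambda>c. Min (T (r, c))) [Suc q..<lam ! r]"
  have ex: "decreasing_word n ?X = hi @ lo"
    by (simp add: decreasing_word_split[OF i] hi_def lo_def)
  have "[0..<lam ! r] = [0..<q] @ q # [Suc q..<lam ! r]"
    using rq by (metis le_add1 less_imp_le_nat plus_nat.add_0 upt_add_eq_append upt_conv_Cons add_diff_inverse_nat less_nat_zero_code not_less)
  then have min: "row_minima lam T r = m1 @ i # m2" "row_minima lam T' r = m1 @ Suc i # m2"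
    using q(3) T'(1,2) by (auto simp: row_minima_def m1_def m2_def)
  have "Suc i \<noteq> Min (T (r, c))" if "c < q" for c using Min_left_of[OF q(1) that] by simp
  then have m1: "Suc i \<notin> set m1" unfolding m1_def set_map set_upt image_iff by simp
  have "i \<noteq> Min (T (r, c))" if "q < c" "c < lam ! r" for c
    using right_of_last[OF q(1,2) that(1) Min_box] diagram_row[OF rq(1) that(2)] by simp
  then have m2: "i \<notin> set m2" unfolding m2_def set_map set_upt image_iff by simp
  show ?thesis
  proof (rule that[of "(hi @ lo) @ m1" m2])
    show "int (wphi i ((hi @ lo) @ m1)) = max 0 (word_diff i ((hi @ lo) @ m1))"
      using wphi_two_parts[of i hi "lo @ m1"] m1 by (auto simp: hi_def lo_def)
    show "count_list ((hi @ lo) @ m1) (Suc i) = of_bool (Suc i \<in> ?X)"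
      using m1 i by (simp add: ex[symmetric] count_decreasing_word count_list_0_iff)
  qed (use m2 in \<open>simp_all add: row_word_def ex min T'(3)\<close>)
qed

text \<open>Since \<open>Suc i\<close> is no extra of the row, replacing \<open>i\<close> by it
  keeps the word of extras decreasing with the letter in place. No minimum of the row equals
  \<open>i\<close>: up to column \<open>q\<close> they are smaller, beyond it larger.\<close>

lemma row_word_split_extra:
  assumes i: "0 < i" "i < n" and q: "i \<in> T (r, q)" "i \<notin> T (r, Suc q)" "Min (T (r, q)) < i"
    and Suc: "Suc i \<notin> extras T r"
    and T': "\<And>c. Min (T' (r, c)) = Min (T (r, c))" "extras T' r = insert (Suc i) (extras T r - {i})"
  obtains u v where "row_word n lam T r = u @ i # v" "row_word n lam T' r = u @ Suc i # v"
    "i \<notin> set v" "int (wphi i u) = max 0 (word_diff i u)"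
    "count_list u (Suc i) = of_bool (Suc i \<in> extras T r)"
proof -
  let ?X = "extras T r"
  have rq: "r < length lam" "q < lam ! r" using entry_row[OF q(1)] by auto
  have iX: "i \<in> ?X" using q extras_iff_Min by auto
  define hi where "hi = filter (\<lambda>v. v \<in> ?X) (rev [Suc (Suc i)..<Suc n])"
  define lo where "lo = filter (\<lambda>v. v \<in> ?X) (rev [1..<i])"
  have ex: "decreasing_word n ?X = hi @ i # lo"
    using iX Suc by (simp add: decreasing_word_split[OF i] hi_def lo_def)
  have "filter (\<lambda>v. v \<in> extras T' r) (rev [Suc (Suc i)..<Suc n]) = hi"
    "filter (\<lambda>v. v \<in> extras T' r) (rev [1..<i]) = lo"
    unfolding hi_def lo_def T'(2) by (rule filter_cong; force)+
  then have ex': "decreasing_word n (extras T' r) = hi @ Suc i # lo"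
    using T'(2) by (simp add: decreasing_word_split[OF i])
  have min: "row_minima lam T' r = row_minima lam T r" by (simp add: row_minima_def T'(1))
  have "i \<noteq> Min (T (r, c))" if "c < lam ! r" for c
  proof -
    have "Min (T (r, q)) \<in> T (r, q)" using Min_box entry_in_diagram[OF q(1)] .
    then have "c < q \<Longrightarrow> Min (T (r, c)) < i" using Min_left_of[of _ r q c] q(3) by fastforce
    moreover have "q < c \<Longrightarrow> i < Min (T (r, c))"
      using right_of_last[OF q(1,2) _ Min_box] diagram_row[OF rq(1) that] by simp
    ultimately show ?thesis using q(3) by (metis less_irrefl linorder_neqE_nat)
  qed
  then have m: "i \<notin> set (row_minima lam T r)"
    unfolding row_minima_def set_map set_upt image_iff by simp
  have hi: "i \<notin> set hi" "Suc i \<notin> set hi" by (auto simp: hi_def)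
  show ?thesis
  proof (rule that[of hi "lo @ row_minima lam T r"])
    show "i \<notin> set (lo @ row_minima lam T r)" using m by (auto simp: lo_def)
    show "int (wphi i hi) = max 0 (word_diff i hi)" using wphi_two_parts[of i hi "[]"] hi by simp
    show "count_list hi (Suc i) = of_bool (Suc i \<in> ?X)" using hi Suc by (simp add: count_list_0_iff)
  qed (simp_all add: row_word_def ex ex' min)
qed

text \<open>The column \<open>q\<close> of the letter changed in the word need not be
  \<open>c\<close>: if \<open>i\<close> is also in the box on the right, that box loses its minimum
  \<open>i\<close>, so \<open>q = Suc c\<close>. The heights after both columns agree because column
  \<open>Suc c\<close> contains \<open>i\<close> and \<open>Suc i\<close>.\<close>

lemma f_row_word:
  assumes f: "f_box i T r c" and i: "0 < i" "i < n"
  obtains q u v where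
    "i \<in> T (r, q)" "i \<notin> T (r, Suc q)" "height i T (Suc q) = height i T (Suc c)"
    "row_word n lam T r = u @ i # v" "row_word n lam (f_at i r c T) r = u @ Suc i # v"
    "i \<notin> set v" "int (wphi i u) = max 0 (word_diff i u)"
    "count_list u (Suc i) = of_bool (Suc i \<in> extras T r)"
    "card (extras (f_at i r c T) r) = card (extras T r)"
proof -
  let ?T' = "f_at i r c T"
  interpret T': svt n lam ?T' using lam f_at_SVT[OF f i] by unfold_locales
  have rc: "i \<in> T (r, c)" and ni: "Suc i \<notin> T (r, c)"
    using f by (auto simp: f_box_def in_column_def)
  show ?thesis
  proof (cases "i \<in> T (r, Suc c)")
    case True
    have Suc: "Suc i \<in> T (r, Suc c)" by (rule f_box_right[OF f True])
    have T': "?T' (r, c) = insert (Suc i) (T (r, c))" "?T' (r, Suc c) = T (r, Suc c) - {i}"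
      "\<And>c'. c' \<noteq> c \<Longrightarrow> c' \<noteq> Suc c \<Longrightarrow> ?T' (r, c') = T (r, c')"
      using True by (auto simp: f_at_def)
    have last: "i \<notin> T (r, Suc (Suc c))" using row_le[OF Suc, of i "Suc (Suc c)"] by auto
    have le: "x \<le> i" if "x \<in> T (r, c)" for x using row_le[OF that True] by simp
    have ge: "i \<le> x" if "x \<in> T (r, Suc c)" for x using row_le[OF rc that] by simp
    have "Min (T (r, Suc c)) = i" using finite_box True ge by (intro Min_eqI) auto
    moreover have "Min (?T' (r, Suc c)) = Suc i"
      using finite_box Suc ge by (intro Min_eqI) (auto simp: T' Suc_le_eq le_neq_implies_less)
    moreover have "Min (?T' (r, c')) = Min (T (r, c'))" if "c' \<noteq> Suc c" for c'
    proof (cases "c' = c")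
      case True
      have "Min (T (r, c)) \<le> Suc i" using Min_box_le[OF rc] by simp
      moreover have "T (r, c) \<noteq> {}" using rc by blast
      ultimately show ?thesis using True finite_box by (simp add: T' min_absorb2)
    qed (use that T' in simp)
    \<comment> \<open>The extra \<open>Suc i\<close> only changes its box: before, it is non-minimal
      in column \<open>Suc c\<close>; afterwards, it is so in column \<open>c\<close>.\<close>
    moreover have "extras ?T' r = extras T r"
    proof (intro equalityI subsetI)
      fix v assume "v \<in> extras ?T' r"
      then obtain d u where d: "v \<in> ?T' (r, d)" "u \<in> ?T' (r, d)" "u < v" by (auto simp: extras_def)
      consider "d = c" "v = Suc i" | "d = c" "v \<in> T (r, c)" | "d = Suc c" | "d \<noteq> c" "d \<noteq> Suc c"
        using d(1) T' by auto
      then show "v \<in> extras T r"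
      proof cases
        case 1
        then show ?thesis using Suc True by (auto simp: extras_def)
      next
        case 2
        then have "u \<in> T (r, c)" using d le[of v] T' by auto
        then show ?thesis using 2 d by (auto simp: extras_def)
      qed (use d T' in \<open>auto simp: extras_def\<close>)
    next
      fix v assume "v \<in> extras T r"
      then obtain d u where d: "v \<in> T (r, d)" "u \<in> T (r, d)" "u < v" by (auto simp: extras_def)
      consider "d = c" | "d = Suc c" "v = Suc i" | "d = Suc c" "v \<noteq> Suc i" | "d \<noteq> c" "d \<noteq> Suc c"
        by blast
      then show "v \<in> extras ?T' r"
      proof cases
        case 2
        then have "v \<in> ?T' (r, c)" "i \<in> ?T' (r, c)" using T' rc by auto
        then show ?thesis using 2 unfolding extras_def by blast
      next
        case 3
        then have "Suc i < v" using ge[of u] d by simp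
        moreover have "v \<in> ?T' (r, Suc c)" "Suc i \<in> ?T' (r, Suc c)" using T' d 3 Suc ge[of u] by auto
        ultimately show ?thesis unfolding extras_def by blast
      next
        case 4
        then have "v \<in> ?T' (r, d)" "u \<in> ?T' (r, d)" using T'(3) d by auto
        then show ?thesis using d(3) unfolding extras_def by blast
      qed (use d T' in \<open>auto simp: extras_def\<close>)
    qed
    moreover have "height i T (Suc (Suc c)) = height i T (Suc c)"
      using True Suc by (auto simp: columns_diff_last[of 0 "Suc c"] column_diff_def in_column_def)
    ultimately show ?thesis
      using row_word_split_Min[OF i True last, of ?T'] that[OF True last] by metis
  next
    case False
    have T': "?T' (r, c) = insert (Suc i) (T (r, c) - {i})"
      "\<And>c'. c' \<noteq> c \<Longrightarrow> ?T' (r, c') = T (r, c')"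
      using False by (auto simp: f_at_def)
    show ?thesis
    proof (cases "Min (T (r, c)) = i")
      case True
      have ge: "i \<le> x" if "x \<in> T (r, c)" for x using Min_box_le[OF that] True by simp
      have "Min (?T' (r, c)) = Suc i"
        using finite_box ge by (intro Min_eqI) (auto simp: T' Suc_le_eq le_neq_implies_less)
      moreover have "extras ?T' r = extras T r"
      proof (intro equalityI subsetI)
        fix v assume "v \<in> extras ?T' r"
        then obtain d u where d: "v \<in> ?T' (r, d)" "u \<in> ?T' (r, d)" "u < v" by (auto simp: extras_def)
        show "v \<in> extras T r"
        proof (cases "d = c")
          case True
          then have "Suc i \<le> u" using d(2) ge[of u] T' by (auto simp: Suc_le_eq le_neq_implies_less)
          then have "v \<in> T (r, c)" "i < v" using d True T' by auto
          then show ?thesis using rc unfolding extras_def by blast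
        qed (use d T' in \<open>auto simp: extras_def\<close>)
      next
        fix v assume "v \<in> extras T r"
        then obtain d u where d: "v \<in> T (r, d)" "u \<in> T (r, d)" "u < v" by (auto simp: extras_def)
        show "v \<in> extras ?T' r"
        proof (cases "d = c")
          case True
          then have "i < v" "v \<noteq> Suc i" using d ge[of u] ni by auto
          then have "v \<in> ?T' (r, c)" "Suc i \<in> ?T' (r, c)" "Suc i < v" using d True T' by auto
          then show ?thesis unfolding extras_def by blast
        next
          case False
          then have "v \<in> ?T' (r, d)" "u \<in> ?T' (r, d)" using T'(2) d by auto
          then show ?thesis using d(3) unfolding extras_def by blast
        qed
      qed
      ultimately show ?thesis
        using row_word_split_Min[OF i rc False True, of ?T'] that[OF rc False] T'(2) by metis
    next
      case False': False
      let ?m = "Min (T (r, c))"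
      have m: "?m \<in> T (r, c)" "?m < i"
        using Min_box[OF entry_in_diagram[OF rc]] Min_box_le[OF rc] False' by auto
      have Suc: "Suc i \<notin> extras T r" using extras_Suc_iff[OF rc False] ni by simp
      have min: "Min (?T' (r, c')) = Min (T (r, c'))" for c'
      proof (cases "c' = c")
        case True
        then show ?thesis using m finite_box Min_box_le[of _ "(r, c)"]
          by (auto simp: T' intro!: Min_eqI)
      qed (simp add: T')
      have ex: "extras ?T' r = insert (Suc i) (extras T r - {i})"
      proof (intro equalityI subsetI)
        fix v assume v: "v \<in> extras ?T' r"
        then obtain d where d: "v \<in> ?T' (r, d)" "v \<noteq> Min (T (r, d))"
          by (auto simp: T'.extras_iff_Min min)
        show "v \<in> insert (Suc i) (extras T r - {i})"
        proof (cases "d = c")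
          case True
          then show ?thesis using d T' by (auto simp: extras_iff_Min)
        next
          case False'': False
          have "v \<noteq> i"
          proof
            assume "v = i"
            then have "i \<in> T (r, d)" using d T'(2)[OF False''] by simp
            then have "\<not> c < d" "\<not> d < c"
              using right_of_last[OF rc False, of d] row_le[OF _ m(1)] m(2) by fastforce+
            then show False using False'' by simp
          qed
          then show ?thesis using d T'(2)[OF False''] by (auto simp: extras_iff_Min)
        qed
      next
        fix v assume v: "v \<in> insert (Suc i) (extras T r - {i})"
        show "v \<in> extras ?T' r"
        proof (cases "v = Suc i")
          case True
          then show ?thesis using m by (auto simp: T'.extras_iff_Min min T' intro!: exI[of _ c])
        next
          case False''': False
          then obtain d where d: "v \<in> T (r, d)" "v \<noteq> Min (T (r, d))" "v \<noteq> i"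
            using v by (auto simp: extras_iff_Min)
          then have "v \<in> ?T' (r, d)" using T' by (cases "d = c") auto
          then show ?thesis using d by (auto simp: T'.extras_iff_Min min)
        qed
      qed
      have iX: "i \<in> extras T r" using rc False' by (auto simp: extras_iff_Min)
      have fin: "finite (extras T r)" using extras_range finite_subset by blast
      have "card (extras ?T' r) = card (extras T r)"
        using Suc card_Suc_Diff1[OF fin iX] fin by (simp add: ex del: card_Diff_insert)
      then show ?thesis
        using row_word_split_extra[OF i rc False m(2) Suc min ex] that[OF rc False] by metis
    qed
  qed
qed

text \<open>The rows below \<open>r\<close> and the part \<open>u\<close> of row \<open>r\<close>
  are shown to stay at most one below the maximal height \<open>M\<close>, with the value
  \<open>M - 1\<close> at the end of \<open>u\<close>. Nothing after the changed letter exceeds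
  \<open>M\<close>, so \<open>word_f_append\<close> applies.\<close>

lemma reading_word_f:
  assumes f: "f_box i T r c" and i: "0 < i" "i < n"
  shows "word_f i (reading_word n lam T) = Some (reading_word n lam (f_at i r c T))"
    and "card (extras (f_at i r c T) r') = card (extras T r')"
proof -
  let ?T' = "f_at i r c T" and ?L = "length lam"
  have other: "?T' (r', c') = T (r', c')" if "r' \<noteq> r" for r' c'
    using that by (simp add: f_at_def)
  obtain q u v where q: "i \<in> T (r, q)" "i \<notin> T (r, Suc q)" "height i T (Suc q) = height i T (Suc c)"
    and row: "row_word n lam T r = u @ i # v" "row_word n lam ?T' r = u @ Suc i # v"
    and uv: "i \<notin> set v" "int (wphi i u) = max 0 (word_diff i u)"
      "count_list u (Suc i) = of_bool (Suc i \<in> extras T r)"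
    and card: "card (extras ?T' r) = card (extras T r)"
    by (rule f_row_word[OF f i])
  show "card (extras ?T' r') = card (extras T r')"
    using card other[of r'] by (cases "r' = r") (auto simp: extras_def)
  have rc: "i \<in> T (r, c)" using f by (simp add: f_box_def)
  have rL: "r < ?L" using entry_row[OF q(1)] by simp
  define M where "M = height i T (Suc c)"
  have Mc: "height i T c = M - 1" using f_box_height[OF f] by (simp add: M_def)
  have peak: "c' \<le> c \<Longrightarrow> height i T c' \<le> M - 1" "height i T c' \<le> M" for c'
    using f Mc by (auto simp: f_box_def peak_step_def M_def not_le) (metis leI less_imp_le zle_diff1_eq zless_imp_add1_zle)+
  let ?B = "rows_word n lam T (Suc r) ?L" and ?A = "rows_word n lam T 0 r"
  have split: "reading_word n lam S = rows_word n lam S (Suc r) ?L @ row_word n lam S r @ rows_word n lam S 0 r" for S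
    using rows_word_append[of 0 r ?L] rows_word_first[of r ?L] rL
    by (simp add: reading_word_def)
  have same: "row_word n lam ?T' r' = row_word n lam T r'" if "r' \<noteq> r" for r'
    using other[OF that] by (simp add: row_word_def extras_def row_minima_def)
  have "rows_word n lam ?T' (Suc r) ?L = ?B" "rows_word n lam ?T' 0 r = ?A"
    by (rule rows_word_cong; use same in force)+
  then have words: "reading_word n lam T = (?B @ u) @ i # (v @ ?A)"
    "reading_word n lam ?T' = (?B @ u) @ Suc i # (v @ ?A)"
    by (simp_all add: split row)
  have v0: "count_list v i = 0" using uv(1) by (simp add: count_list_0_iff)
  \<comment> \<open>\<open>height_row\<close> gives \<open>M\<close> after the last \<open>i\<close>
    of the row, which is the letter to be changed; just before it the sum is one less.\<close>
  have dBu: "word_diff i ?B + word_diff i u = M - 1"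
    using height_row[OF i q(1,2)] q(3) uv(3) v0 by (simp add: row M_def word_diff_def)
  \<comment> \<open>In the rows below \<open>r\<close> every \<open>i\<close> lies strictly left of
    column \<open>c\<close>, hence before the peak, where the heights are at most
    \<open>M - 1\<close>.\<close>
  have "word_diff i (rows_word n lam T ?L ?L) + int (wphi i ?B) \<le> M - 1"
  proof (rule rows_bound[OF i])
    show "word_diff i (rows_word n lam T ?L ?L) \<le> M - 1" using peak(1)[of 0] by simp
    fix r' q' assume r': "Suc r \<le> r'" "i \<in> T (r', q')"
    have "\<not> c \<le> q'"
    proof
      assume "c \<le> q'"
      have "(r, q') \<in> diagram lam" using diagram_mono[OF entry_in_diagram[OF r'(2)]] r'(1) by simp
      then obtain y where y: "y \<in> T (r, q')" using nonempty by blast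
      have "y < i" using column_less[OF y r'(2)] r'(1) by simp
      moreover have "i \<le> y" if "c < q'" using row_le[OF rc y that] .
      moreover have "c \<noteq> q'" using column_unique[OF rc] r' by auto
      ultimately show False using \<open>c \<le> q'\<close> by simp
    qed
    then show "height i T (Suc q') \<le> M - 1" using peak(1) by simp
  qed (use rL in auto)
  then have phiB: "int (wphi i ?B) \<le> M - 1" by simp
  have "int (wphi i (?B @ u)) = word_diff i (?B @ u)"
    using wphi_append[of i ?B u] phiB dBu word_diff_le_wphi[of i ?B] uv(2) by simp
  moreover have "wphi i (v @ ?A) = 0"
  proof -
    have dr: "word_diff i (rows_word n lam T r ?L) = M + word_diff i v"
      using dBu rL by (simp add: rows_word_first row)
    have "word_diff i v \<le> 0" using v0 by (simp add: word_diff_def)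
    then have "word_diff i (rows_word n lam T r ?L) + int (wphi i ?A) \<le> M"
      by (intro rows_bound[OF i]) (use dr rL peak(2) in auto)
    then show ?thesis using wphi_append[of i v ?A] wphi_eq_0[OF uv(1)] dr by simp
  qed
  ultimately show "word_f i (reading_word n lam T) = Some (reading_word n lam ?T')"
    unfolding words by (rule word_f_append)
qed

lemma height_total:
  assumes i: "0 < i" "i < n"
  shows "height i T (num_columns lam) = word_diff i (reading_word n lam T)"
proof -
  have "{c. c < num_columns lam \<and> in_column j c T} = (\<Union>r\<in>{0..<length lam}. {c. j \<in> T (r, c)})" for j
  proof -
    have "c < num_columns lam" "r < length lam" if "j \<in> T (r, c)" for r c
      using in_column_less[of j c] entry_row[OF that] that by (auto simp: in_column_def)
    then show ?thesis unfolding in_column_def by fastforce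
  qed
  then show ?thesis
    using i card_columns[of "{0..<length lam}"] count_rows_word[of _ "length lam" 0]
    by (simp add: height_eq_card word_diff_def reading_word_def)
qed

lemma word_f_reading_None:
  assumes i: "0 < i" "i < n" and h: "\<And>c. height i T c \<le> 0"
  shows "word_f i (reading_word n lam T) = None"
  using rows_bound[OF i, of 0 "length lam" 0] h
  by (simp add: word_f_None_iff reading_word_def)

lemma word_e_reading_None:
  assumes i: "0 < i" "i < n" and h: "\<And>c. height i T c \<le> height i T (num_columns lam)"
  shows "word_e i (reading_word n lam T) = None"
proof (rule word_e_None)
  have "int (wphi i (reading_word n lam T)) \<le> height i T (num_columns lam)"
    using rows_bound[OF i, of 0 "length lam" "height i T (num_columns lam)"] h h[of 0]
    by (simp add: reading_word_def)
  then show "int (wphi i (reading_word n lam T)) = word_diff i (reading_word n lam T)"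
    using height_total[OF i] word_diff_le_wphi[of i "reading_word n lam T"] by simp
qed

lemma reading_svt_f:
  assumes i: "0 < i" "i < n"
  shows "map_option (reading_word n lam) (svt_f lam i T) = word_f i (reading_word n lam T)"
proof (cases rule: svt_f_cases[of i])
  case None
  then show ?thesis using word_f_reading_None[OF i] by simp
next
  case (Some r c)
  then show ?thesis using reading_word_f(1)[OF Some(1) i] by simp
qed

lemma svt_f_SomeD:
  assumes i: "0 < i" "i < n" and S: "svt_f lam i T = Some S"
  shows "S \<in> SVT n lam" "card (extras S r) = card (extras T r)"
proof -
  obtain r' c where "f_box i T r' c" "S = f_at i r' c T"
    using S by (cases rule: svt_f_cases[of i]) auto
  then show "S \<in> SVT n lam" "card (extras S r) = card (extras T r)"
    using f_at_SVT[OF _ i] reading_word_f(2)[OF _ i] by simp_all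
qed

lemma svt_e_SomeD:
  assumes i: "0 < i" "i < n" and S: "svt_e lam i T = Some S"
  shows "S \<in> SVT n lam" "svt_f lam i S = Some T" "card (extras S r) = card (extras T r)"
proof -
  obtain r' c where S: "e_box i T r' c" "S = e_at i r' c T"
    using S by (cases rule: svt_e_cases[of i]) auto
  show *: "S \<in> SVT n lam" using e_at_SVT[OF _ i] S by simp
  interpret S: svt n lam S using lam * by unfold_locales
  show "svt_f lam i S = Some T" using f_of_e_at[OF _ i] S by simp
  then show "card (extras S r) = card (extras T r)" using S.svt_f_SomeD(2)[OF i] by simp
qed

text \<open>Heights are needed only if no - survives. Otherwise the equation
  \<open>f_i (e_i T) = T\<close> is read on words and inverted there, so the boxes changed by
  \<open>e_i\<close> need not be followed.\<close>

lemma reading_svt_e: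
  assumes i: "0 < i" "i < n"
  shows "map_option (reading_word n lam) (svt_e lam i T) = word_e i (reading_word n lam T)"
proof (cases "svt_e lam i T")
  case None
  then show ?thesis using word_e_reading_None[OF i] by (cases rule: svt_e_cases[of i]) auto
next
  case (Some S)
  interpret S: svt n lam S using lam svt_e_SomeD(1)[OF i Some] by unfold_locales
  have "word_f i (reading_word n lam S) = Some (reading_word n lam T)"
    using S.reading_svt_f[OF i] svt_e_SomeD(2)[OF i Some] by simp
  then show ?thesis using Some by (simp flip: word_e_iff_f)
qed

section \<open>Recovering a tableau from its reading word\<close>

lemma set_reading_word: "set (reading_word n lam T) \<subseteq> {1..n}"
proof -
  have "Min (T (r, c)) \<in> {1..n}" if "r < length lam" "c < lam ! r" for r c
    using entry_range[OF Min_box[OF diagram_row[OF that]]] by simp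
  then show ?thesis
    by (auto simp: reading_word_def rows_word_def row_word_def set_decreasing_word row_minima_def)
qed

text \<open>An extra lies in the last box of its row whose minimum is smaller than it, because the
  minima further right are at least as large.\<close>

lemma box_eq:
  assumes "r < length lam" "c < lam ! r"
  shows "T (r, c) = insert (Min (T (r, c)))
    {v \<in> extras T r. Min (T (r, c)) < v \<and> (\<forall>c'. c < c' \<and> c' < lam ! r \<longrightarrow> v \<le> Min (T (r, c')))}"
proof (intro equalityI subsetI)
  fix v assume v: "v \<in> T (r, c)"
  have "v \<in> extras T r \<and> Min (T (r, c)) < v" if "v \<noteq> Min (T (r, c))"
    using v that Min_box_le[OF v] by (auto simp: extras_iff_Min)
  moreover have "v \<le> Min (T (r, c'))" if "c < c'" "c' < lam ! r" for c'
    using Min_right_of[OF v that(1)] diagram_row assms that by simp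
  ultimately show "v \<in> insert (Min (T (r, c)))
    {v \<in> extras T r. Min (T (r, c)) < v \<and> (\<forall>c'. c < c' \<and> c' < lam ! r \<longrightarrow> v \<le> Min (T (r, c')))}"
    by blast
next
  fix v assume "v \<in> insert (Min (T (r, c)))
    {v \<in> extras T r. Min (T (r, c)) < v \<and> (\<forall>c'. c < c' \<and> c' < lam ! r \<longrightarrow> v \<le> Min (T (r, c')))}"
  then consider "v = Min (T (r, c))" | "v \<in> extras T r" "Min (T (r, c)) < v"
      "\<forall>c'. c < c' \<and> c' < lam ! r \<longrightarrow> v \<le> Min (T (r, c'))" by blast
  then show "v \<in> T (r, c)"
  proof cases
    case 1
    then show ?thesis using Min_box diagram_row assms by simp
  next
    case 2
    then obtain d where d: "v \<in> T (r, d)" "v \<noteq> Min (T (r, d))" by (auto simp: extras_iff_Min)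
    have "\<not> c < d" using 2(3) entry_row[OF d(1)] d(2) Min_box_le[OF d(1)] by (metis le_antisym)
    moreover have "\<not> d < c" using Min_right_of[OF d(1)] 2(2) diagram_row[OF assms] by fastforce
    ultimately show ?thesis using d by (metis linorder_neqE_nat)
  qed
qed

lemma finite_extras: "finite (extras T r)"
  using extras_range finite_subset by blast

lemma length_row_word: "length (row_word n lam T r) = card (extras T r) + lam ! r"
  using distinct_card[OF distinct_decreasing_word[of n "extras T r"]] extras_range[of r]
  by (simp add: row_word_def row_minima_def set_decreasing_word Int_absorb1)

text \<open>The numbers of extras fix the lengths of the row words, so the word can be cut into
  rows. The last \<open>lam ! r\<close> letters of a row word are the minima, and
  \<open>box_eq\<close> rebuilds the boxes.\<close>

lemma reading_word_inj:
  assumes "S \<in> SVT n lam" and word: "reading_word n lam S = reading_word n lam T"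
    and card: "\<And>r. card (extras S r) = card (extras T r)"
  shows "S = T"
proof -
  interpret S: svt n lam S using lam assms(1) by unfold_locales
  have rows: "map (row_word n lam S) (rev [0..<length lam]) = map (row_word n lam T) (rev [0..<length lam])"
    by (rule concat_injective)
      (use word card length_row_word S.length_row_word in
        \<open>auto simp: reading_word_def rows_word_def set_zip\<close>)
  have "S (r, c) = T (r, c)" for r c
  proof (cases "(r, c) \<in> diagram lam")
    case False
    then show ?thesis using entry_in_diagram S.entry_in_diagram by blast
  next
    case True
    then have r: "r < length lam" and c: "c < lam ! r" by (auto simp: diagram_def)
    have "row_word n lam S r = row_word n lam T r" using rows r by simp
    then have "decreasing_word n (extras S r) = decreasing_word n (extras T r)"
      and min: "row_minima lam S r = row_minima lam T r"
      by (auto simp: row_word_def row_minima_def)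
    then have "extras S r = extras T r"
      using set_decreasing_word extras_range[of r] S.extras_range[of r] by (metis Int_absorb1)
    moreover have "Min (S (r, c)) = Min (T (r, c))" if "c < lam ! r" for c
      using arg_cong[OF min, of "\<lambda>w. w ! c"] that by (simp add: row_minima_def)
    ultimately show ?thesis using box_eq[OF r c] S.box_eq[OF r c] c by simp
  qed
  then show ?thesis by (simp add: fun_eq_iff)
qed

text \<open>On words \<open>e_i\<close> undoes \<open>f_i\<close>; the tableau \<open>T'\<close>
  obtained from \<open>S\<close> thus has the word of \<open>T\<close> and the same numbers of
  extras, and injectivity gives \<open>T' = T\<close>.\<close>

lemma svt_e_of_f:
  assumes i: "0 < i" "i < n" and S: "svt_f lam i T = Some S"
  shows "svt_e lam i S = Some T"
proof -
  interpret S: svt n lam S using lam svt_f_SomeD(1)[OF i S] by unfold_locales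
  have "word_e i (reading_word n lam S) = Some (reading_word n lam T)"
    using reading_svt_f[OF i] S by (simp add: word_e_iff_f)
  then obtain T' where T': "svt_e lam i S = Some T'" "reading_word n lam T' = reading_word n lam T"
    using S.reading_svt_e[OF i] by auto
  have "T' = T"
    using reading_word_inj T' S.svt_e_SomeD[OF i T'(1)] svt_f_SomeD(2)[OF i S] by simp
  then show ?thesis using T' by simp
qed

lemma weight_eq: "weight n T = map (count_list (reading_word n lam T)) [1..<n + 1]"
proof -
  have "card {b. j \<in> T b} = count_list (reading_word n lam T) j" if "0 < j" "j \<le> n" for j
  proof -
    have "{b. j \<in> T b} = (SIGMA r:{0..<length lam}. {c. j \<in> T (r, c)})"
      using entry_row by auto
    moreover have "finite {c. j \<in> T (r, c)}" for r
      by (rule finite_subset[of _ "{..<lam ! r}"]) (use entry_row in auto)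
    ultimately show ?thesis
      using that count_rows_word[of j "length lam" 0] by (simp add: reading_word_def)
  qed
  then show ?thesis unfolding weight_def by (intro map_cong refl) (auto simp del: upt_Suc)
qed

text \<open>Stated through \<open>card\<close> because that is the quantity known to be constant on
  components; closedness of \<open>SSYT\<close> follows at once.\<close>

lemma SSYT_iff: "T \<in> SSYT n lam \<longleftrightarrow> (\<forall>r. card (extras T r) = 0)"
proof
  assume "T \<in> SSYT n lam"
  then have "is_singleton (T b)" if "b \<in> diagram lam" for b using that by (simp add: SSYT_def)
  then have "extras T r = {}" for r
    using entry_in_diagram by (fastforce simp: extras_def is_singleton_def)
  then show "\<forall>r. card (extras T r) = 0" by simp
next
  assume "\<forall>r. card (extras T r) = 0"
  then have ex: "extras T r = {}" for r using finite_extras by simp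
  have "is_singleton (T (r, c))" if "(r, c) \<in> diagram lam" for r c
    using box_eq[of r c] that ex[of r] unfolding is_singleton_def by (auto simp: diagram_def)
  then show "T \<in> SSYT n lam" using T by (auto simp: SSYT_def)
qed

end

section \<open>Components\<close>

lemma sum_list_word_e: "word_e i w = Some v \<Longrightarrow> sum_list w = Suc (sum_list v)"
  by (induction w arbitrary: v) (auto split: if_splits)

lemma yamanouchi_word_append: "yamanouchi_word n (u @ v) \<Longrightarrow> yamanouchi_word n v"
  by (induction u) (auto dest: yamanouchi_word_Cons)

abbreviation component :: "nat \<Rightarrow> nat list \<Rightarrow> filling \<Rightarrow> filling set" where
  "component n lam T \<equiv> crystal_closure n (SVT_crystal n lam) T"

lemma component_trans: "U \<in> component n lam S \<Longrightarrow> S \<in> component n lam T \<Longrightarrow> U \<in> component n lam T"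
  by (induction rule: crystal_closure.induct) (auto intro: crystal_closure.intros)

context svt
begin

lemma component_SVT:
  "S \<in> component n lam T \<Longrightarrow> S \<in> SVT n lam \<and> (\<forall>r. card (extras S r) = card (extras T r))"
proof (induction rule: crystal_closure.induct)
  case base
  then show ?case using T by simp
next
  case (e_closed S i U)
  interpret S: svt n lam S using lam e_closed.IH by unfold_locales auto
  show ?case using S.svt_e_SomeD[of i U] e_closed by (simp add: SVT_crystal_def)
next
  case (f_closed S i U)
  interpret S: svt n lam S using lam f_closed.IH by unfold_locales auto
  show ?case using S.svt_f_SomeD[of i U] f_closed by (simp add: SVT_crystal_def)
qed

lemma component_sym: "S \<in> component n lam T \<Longrightarrow> T \<in> component n lam S"
proof (induction rule: crystal_closure.induct)
  case base
  show ?case by (rule crystal_closure.base)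
next
  case (e_closed S i U)
  interpret S: svt n lam S using lam component_SVT[OF e_closed.hyps(1)] by unfold_locales auto
  have "svt_f lam i U = Some S" using S.svt_e_SomeD[of i U] e_closed.hyps by (simp add: SVT_crystal_def)
  then have "S \<in> component n lam U"
    using crystal_closure.f_closed[OF crystal_closure.base, of i n "SVT_crystal n lam" U S] e_closed.hyps
    by (simp add: SVT_crystal_def)
  then show ?case using e_closed.IH component_trans by blast
next
  case (f_closed S i U)
  interpret S: svt n lam S using lam component_SVT[OF f_closed.hyps(1)] by unfold_locales auto
  have "svt_e lam i U = Some S" using S.svt_e_of_f[of i U] f_closed.hyps by (simp add: SVT_crystal_def)
  then have "S \<in> component n lam U"
    using crystal_closure.e_closed[OF crystal_closure.base, of i n "SVT_crystal n lam" U S] f_closed.hyps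
    by (simp add: SVT_crystal_def)
  then show ?case using f_closed.IH component_trans by blast
qed

lemma yamanouchi_iff: "T \<in> yamanouchi n lam \<longleftrightarrow> yamanouchi_word n (reading_word n lam T)"
proof -
  have "svt_e lam i T = None \<longleftrightarrow> word_e i (reading_word n lam T) = None" if "i \<in> {1..<n}" for i
    using that by (simp flip: reading_svt_e)
  then show ?thesis using T by (simp add: yamanouchi_def yamanouchi_word_def)
qed

lemma weight_nth: "j < n \<Longrightarrow> weight n T ! j = count_list (reading_word n lam T) (Suc j)"
  by (simp add: weight_eq del: upt_Suc)

lemma yamanouchi_weight_partition:
  assumes "T \<in> yamanouchi n lam"
  shows "is_partition (weight n T)"
proof -
  have len: "length (weight n T) = n" by (simp add: weight_def)
  have "weight n T ! Suc j \<le> weight n T ! j" if "Suc j < n" for j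
    using yamanouchi_word_count[of n _ "Suc j"] assms that by (simp add: weight_nth yamanouchi_iff)
  then show ?thesis
    unfolding is_partition_def
    by (subst sorted_wrt_iff_nth_Suc_transp) (auto simp: len intro: transpI)
qed

text \<open>Raising terminates because $e_i$ lowers the sum of the letters.\<close>

lemma ex_yamanouchi:
  assumes "S \<in> SVT n lam"
  shows "\<exists>U \<in> yamanouchi n lam. S \<in> component n lam U"
  using assms
proof (induction "sum_list (reading_word n lam S)" arbitrary: S rule: less_induct)
  case less
  interpret S: svt n lam S using lam less.prems by unfold_locales
  show ?case
  proof (cases "S \<in> yamanouchi n lam")
    case True
    then show ?thesis using crystal_closure.base by fastforce
  next
    case False
    then obtain i U where i: "i \<in> {1..<n}" "svt_e lam i S = Some U"
      using less.prems by (auto simp: yamanouchi_def)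
    have U: "U \<in> SVT n lam" "svt_f lam i U = Some S"
      using S.svt_e_SomeD[of i U] i by auto
    have "word_e i (reading_word n lam S) = Some (reading_word n lam U)"
      using S.reading_svt_e[of i] i by simp
    then have "sum_list (reading_word n lam U) < sum_list (reading_word n lam S)"
      by (simp add: sum_list_word_e)
    from less.hyps[OF this U(1)] obtain V where "V \<in> yamanouchi n lam" "U \<in> component n lam V" by blast
    then show ?thesis
      using crystal_closure.f_closed[of U n "SVT_crystal n lam" V i S] i U(2)
      by (auto simp: SVT_crystal_def)
  qed
qed

end

text \<open>The path of operators from \<open>T\<close> to \<open>T'\<close> can be repeated from
  \<open>S\<close>, since definedness and result of each step are visible on the word. Two arbitrary
  shapes are allowed so that the lemma serves an automorphism and its inverse.\<close>

lemma component_transport: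
  assumes "is_partition lam" "T \<in> SVT n lam" "is_partition mu" "S \<in> SVT n mu"
    and base: "reading_word n mu S = h (reading_word n lam T)"
    and e: "\<And>i w. word_e i (h w) = map_option h (word_e i w)"
    and f: "\<And>i w. word_f i (h w) = map_option h (word_f i w)"
    and "T' \<in> component n lam T"
  shows "\<exists>S' \<in> component n mu S. reading_word n mu S' = h (reading_word n lam T')"
  using assms(8)
proof (induction rule: crystal_closure.induct)
  case base
  show ?case using assms(5) crystal_closure.base[of S n "SVT_crystal n mu"] by blast
next
  case (e_closed U i U')
  interpret T: svt n lam T using assms by unfold_locales
  interpret S: svt n mu S using assms by unfold_locales
  interpret U: svt n lam U using T.lam T.component_SVT[OF e_closed.hyps(1)] by unfold_locales auto
  obtain V where V: "V \<in> component n mu S" "reading_word n mu V = h (reading_word n lam U)"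
    using e_closed.IH by blast
  interpret V: svt n mu V using S.lam S.component_SVT[OF V(1)] by unfold_locales auto
  have i: "0 < i" "i < n" using e_closed.hyps by auto
  have "word_e i (reading_word n mu V) = Some (h (reading_word n lam U'))"
    using U.reading_svt_e[OF i, symmetric] e_closed.hyps(3) e V(2) by (simp add: SVT_crystal_def)
  then obtain V' where "svt_e mu i V = Some V'" "reading_word n mu V' = h (reading_word n lam U')"
    using V.reading_svt_e[OF i] by auto
  moreover have "V' \<in> component n mu S" if "svt_e mu i V = Some V'" for V'
    using crystal_closure.e_closed[OF V(1) e_closed.hyps(2)] that by (simp add: SVT_crystal_def)
  ultimately show ?case by blast
next
  case (f_closed U i U')
  interpret T: svt n lam T using assms by unfold_locales
  interpret S: svt n mu S using assms by unfold_locales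
  interpret U: svt n lam U using T.lam T.component_SVT[OF f_closed.hyps(1)] by unfold_locales auto
  obtain V where V: "V \<in> component n mu S" "reading_word n mu V = h (reading_word n lam U)"
    using f_closed.IH by blast
  interpret V: svt n mu V using S.lam S.component_SVT[OF V(1)] by unfold_locales auto
  have i: "0 < i" "i < n" using f_closed.hyps by auto
  have "word_f i (reading_word n mu V) = Some (h (reading_word n lam U'))"
    using U.reading_svt_f[OF i, symmetric] f_closed.hyps(3) f V(2) by (simp add: SVT_crystal_def)
  then obtain V' where "svt_f mu i V = Some V'" "reading_word n mu V' = h (reading_word n lam U')"
    using V.reading_svt_f[OF i] by auto
  moreover have "V' \<in> component n mu S" if "svt_f mu i V = Some V'" for V'
    using crystal_closure.f_closed[OF V(1) f_closed.hyps(2)] that by (simp add: SVT_crystal_def)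
  ultimately show ?case by blast
qed

section \<open>The highest weight element of \<open>B(mu)\<close> and connectedness\<close>

definition superstandard :: "nat list \<Rightarrow> filling" where
  "superstandard mu = (\<lambda>b. if b \<in> diagram mu then {Suc (fst b)} else {})"

lemma superstandard_SSYT:
  assumes "is_partition mu" "length mu = n"
  shows "superstandard mu \<in> SSYT n mu"
  using assms by (auto simp: SSYT_def SVT_iff superstandard_def diagram_def split: if_splits)

lemma reading_superstandard:
  assumes "length mu = n"
  shows "reading_word n mu (superstandard mu) = canonical n (\<lambda>j. mu ! (j - 1))"
proof -
  have "row_word n mu (superstandard mu) r = replicate (mu ! r) (Suc r)" if "r < n" for r
  proof -
    have "extras (superstandard mu) r = {}"
      by (auto simp: extras_def superstandard_def split: if_splits)
    moreover have "row_minima mu (superstandard mu) r = replicate (mu ! r) (Suc r)"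
      unfolding row_minima_def map_replicate_const[symmetric]
      using that assms by (auto simp: superstandard_def diagram_def map_replicate_const intro!: nth_equalityI)
    ultimately show ?thesis by (simp add: row_word_def decreasing_word_def)
  qed
  then have "rows_word n mu (superstandard mu) 0 k = canonical k (\<lambda>j. mu ! (j - 1))" if "k \<le> n" for k
    using that by (induction k) (auto simp: rows_word_def)
  then show ?thesis using assms by (simp add: reading_word_def)
qed

context svt
begin

text \<open>Induction over the rows. If row \<open>r\<close> ended in \<open>z > Suc r\<close>, the
  suffix of the word from this letter on would be Yamanouchi, so \<open>z - 1\<close> would have to
  occur in the rows above; by induction these contain only letters up to \<open>r\<close>.\<close>

lemma SSYT_yamanouchi:
  assumes SSYT: "T \<in> SSYT n lam" and Y: "T \<in> yamanouchi n lam"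
  shows "T = superstandard lam"
proof -
  have ex: "extras T r = {}" for r using SSYT SSYT_iff finite_extras by simp
  have row: "row_word n lam T r = row_minima lam T r" for r
    by (simp add: row_word_def ex decreasing_word_def)
  have main: "r < length lam \<Longrightarrow> x \<in> T (r, c) \<Longrightarrow> x = Suc r" for r c x
  proof (induction r arbitrary: c x rule: less_induct)
    case (less r)
    let ?l = "lam ! r"
    have c: "c < ?l" using entry_row[OF less.prems(2)] by simp
    have low: "Suc r \<le> x"
    proof (cases r)
      case 0
      then show ?thesis using entry_range[OF less.prems(2)] by simp
    next
      case (Suc r')
      have "(r', c) \<in> diagram lam" using diagram_mono[OF entry_in_diagram[OF less.prems(2)]] Suc by simp
      then obtain y where y: "y \<in> T (r', c)" using nonempty by blast
      then have "y = r" using less.IH[of r' y c] less.prems(1) Suc by simp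
      then show ?thesis using column_less[OF y less.prems(2)] Suc by simp
    qed
    define z where "z = Min (T (r, ?l - 1))"
    have last: "(r, ?l - 1) \<in> diagram lam" using diagram_row[OF less.prems(1)] c by simp
    have z: "z \<in> T (r, ?l - 1)" unfolding z_def by (rule Min_box[OF last])
    have "x \<le> z"
    proof (cases "c = ?l - 1")
      case True
      have "x \<notin> extras T r" using ex by simp
      then show ?thesis using True less.prems(2) z_def by (auto simp: extras_iff_Min)
    next
      case False
      then show ?thesis using row_le[OF less.prems(2) z] c by simp
    qed
    moreover have "z \<le> Suc r"
    proof (rule ccontr)
      assume "\<not> z \<le> Suc r"
      then obtain i where i: "z = Suc i" "r < i" by (cases z) auto
      have "i < n" using entry_range[OF z] i by simp
      have "[0..<?l] = [0..<?l - 1] @ [?l - 1]" using c by (cases ?l) auto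
      then have "row_minima lam T r = map (\<lambda>c. Min (T (r, c))) [0..<?l - 1] @ [z]"
        by (simp add: row_minima_def z_def)
      moreover have "reading_word n lam T =
          rows_word n lam T (Suc r) (length lam) @ row_minima lam T r @ rows_word n lam T 0 r"
        using rows_word_append[of 0 r "length lam"] rows_word_first[of r "length lam"] less.prems(1)
        by (simp add: reading_word_def row)
      ultimately have "\<exists>u. reading_word n lam T = u @ z # rows_word n lam T 0 r" by simp
      then have "yamanouchi_word n (z # rows_word n lam T 0 r)"
        using Y yamanouchi_iff yamanouchi_word_append by metis
      then have "word_e i (z # rows_word n lam T 0 r) = None"
        using i \<open>i < n\<close> by (simp add: yamanouchi_word_def del: word_e.simps)
      then have "i \<in> set (rows_word n lam T 0 r)"
        using i wphi_eq_0 unfolding word_e_Cons_None_iff by blast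
      then obtain r' c' where r': "r' < r" "c' < lam ! r'" "i = Min (T (r', c'))"
        by (auto simp: rows_word_def row row_minima_def)
      then have "i \<in> T (r', c')" using Min_box diagram_row less.prems(1) by simp
      then have "i = Suc r'" using less.IH[of r' i c'] r'(1) less.prems(1) by simp
      then show False using r' i by simp
    qed
    ultimately show ?case using low by simp
  qed
  show ?thesis
  proof
    fix b :: box
    obtain r c where b: "b = (r, c)" by (cases b)
    show "T b = superstandard lam b"
    proof (cases "b \<in> diagram lam")
      case True
      then obtain x where "x \<in> T b" using nonempty by blast
      moreover have "r < length lam" using True b by (simp add: diagram_def)
      ultimately show ?thesis using main[of r _ c] True b by (auto simp: superstandard_def)
    next
      case False
      then show ?thesis using entry_in_diagram[of _ b] by (auto simp: superstandard_def)
    qed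
  qed
qed

lemma SSYT_closed:
  assumes i: "0 < i" "i < n" and "T \<in> SSYT n lam"
  shows "svt_e lam i T = Some S \<Longrightarrow> S \<in> SSYT n lam" "svt_f lam i T = Some S \<Longrightarrow> S \<in> SSYT n lam"
proof -
  have *: "S \<in> SSYT n lam" if "S \<in> SVT n lam" "\<And>r. card (extras S r) = card (extras T r)"
  proof -
    interpret S: svt n lam S using lam that(1) by unfold_locales
    show ?thesis using S.SSYT_iff that(2) assms(3) SSYT_iff by simp
  qed
  show "svt_e lam i T = Some S \<Longrightarrow> S \<in> SSYT n lam" using * svt_e_SomeD[OF i] by blast
  show "svt_f lam i T = Some S \<Longrightarrow> S \<in> SSYT n lam" using * svt_f_SomeD[OF i] by blast
qed

end

lemma SSYT_eqI:
  assumes "is_partition mu" "S \<in> SSYT n mu" "S' \<in> SSYT n mu" "reading_word n mu S = reading_word n mu S'"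
  shows "S = S'"
proof -
  interpret S: svt n mu S using assms by unfold_locales (simp_all add: SSYT_def)
  interpret S': svt n mu S' using assms by unfold_locales (simp_all add: SSYT_def)
  show ?thesis using S'.reading_word_inj[OF S.T assms(4)] S.SSYT_iff S'.SSYT_iff assms by simp
qed

text \<open>Raising any element of \<open>SSYT\<close> ends in a Yamanouchi tableau without extras,
  and there is only one. So \<open>B(mu)\<close> is connected.\<close>

lemma SSYT_eq_component:
  assumes mu: "is_partition mu" "length mu = n"
  shows "SSYT n mu = component n mu (superstandard mu)"
proof (intro equalityI subsetI)
  have S0: "superstandard mu \<in> SSYT n mu" by (rule superstandard_SSYT[OF mu])
  interpret S0: svt n mu "superstandard mu" using mu S0 by unfold_locales (simp_all add: SSYT_def)
  fix S assume S: "S \<in> component n mu (superstandard mu)"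
  interpret S: svt n mu S using mu S0.component_SVT[OF S] by unfold_locales simp_all
  show "S \<in> SSYT n mu" using S.SSYT_iff S0.SSYT_iff S0 S0.component_SVT[OF S] by simp
next
  fix S assume S: "S \<in> SSYT n mu"
  interpret S: svt n mu S using mu S by unfold_locales (simp_all add: SSYT_def)
  obtain U where U: "U \<in> yamanouchi n mu" "S \<in> component n mu U" using S.ex_yamanouchi[OF S.T] by blast
  interpret U: svt n mu U using mu U by unfold_locales (simp_all add: yamanouchi_def)
  have "U \<in> SSYT n mu" using U.component_SVT[OF U(2)] S.SSYT_iff U.SSYT_iff S by simp
  then show "S \<in> component n mu (superstandard mu)" using U.SSYT_yamanouchi U by simp
qed

section \<open>The component of a Yamanouchi tableau\<close>

context svt
begin

lemma component_iso:
  assumes Y: "T \<in> yamanouchi n lam"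
  obtains H where "bij_betw H (component n lam T) (SSYT n (weight n T))"
    "\<And>S. S \<in> component n lam T \<Longrightarrow> weight n (H S) = weight n S"
    "\<And>S i. S \<in> component n lam T \<Longrightarrow> 0 < i \<Longrightarrow> i < n \<Longrightarrow>
      svt_e (weight n T) i (H S) = map_option H (svt_e lam i S)"
    "\<And>S i. S \<in> component n lam T \<Longrightarrow> 0 < i \<Longrightarrow> i < n \<Longrightarrow>
      svt_f (weight n T) i (H S) = map_option H (svt_f lam i S)"
proof -
  define mu where "mu = weight n T"
  let ?S0 = "superstandard mu" and ?R = "reading_word n lam" and ?Q = "reading_word n mu"
  let ?C = "component n lam T"
  have mu: "is_partition mu" "length mu = n"
    using yamanouchi_weight_partition[OF Y] by (simp_all add: mu_def weight_def)
  have S0: "?S0 \<in> SVT n mu" using superstandard_SSYT[OF mu] by (simp add: SSYT_def)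
  \<comment> \<open>Both words have letter counts \<open>mu\<close>, so the normal form of the word
    of \<open>T\<close> is the word of the superstandard tableau.\<close>
  have "canonical n (count_list (?R T)) = ?Q ?S0"
    unfolding reading_superstandard[OF mu(2)]
    by (rule canonical_cong) (use weight_nth in \<open>simp add: mu_def\<close>)
  then have pl: "plactic (?R T) (?Q ?S0)"
    using plactic_canonical[of n "?R T"] Y yamanouchi_iff set_reading_word by simp
  obtain h k where h: "h (?R T) = ?Q ?S0" "\<And>w. h (k w) = w" "\<And>w. k (h w) = w"
    "\<And>w j. count_list (h w) j = count_list w j"
    "\<And>i w. word_f i (h w) = map_option h (word_f i w)"
    "\<And>i w. word_e i (h w) = map_option h (word_e i w)"
    by (rule plactic_automorphism[OF pl]; rule that)
  have k: "word_f i (k w) = map_option k (word_f i w)" "word_e i (k w) = map_option k (word_e i w)" for i w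
    using h(5)[of i "k w"] h(6)[of i "k w"] h(2,3) by (simp_all add: option.map_comp comp_def option.map_ident)
  have image: "\<exists>S' \<in> SSYT n mu. ?Q S' = h (?R S)" if "S \<in> ?C" for S
    using component_transport[OF lam T mu(1) S0 h(1)[symmetric] h(6,5) that] SSYT_eq_component[OF mu] by simp
  \<comment> \<open>The inverse \<open>k\<close> also commutes with the operators, so transport
    works backwards and yields surjectivity.\<close>
  have preimage: "\<exists>S \<in> ?C. ?R S = k (?Q S')" if "S' \<in> SSYT n mu" for S'
    by (rule component_transport[OF mu(1) S0 lam T _ k(2,1)])
      (use h(1,3) that SSYT_eq_component[OF mu] in \<open>simp_all flip: h(1)\<close>)
  \<comment> \<open>The choice is unique: elements of \<open>SSYT\<close> have no extras, so their
    words determine them. By \<open>H_eq\<close>, commuting with the operators then reduces to an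
    equality of words.\<close>
  define H where "H S = (SOME S'. S' \<in> SSYT n mu \<and> ?Q S' = h (?R S))" for S
  have H: "H S \<in> SSYT n mu" "?Q (H S) = h (?R S)" if "S \<in> ?C" for S
    using someI_ex[of "\<lambda>S'. S' \<in> SSYT n mu \<and> ?Q S' = h (?R S)"] image[OF that] unfolding H_def by blast+
  have H_eq: "H S = S'" if "S \<in> ?C" "S' \<in> SSYT n mu" "?Q S' = h (?R S)" for S S'
    using SSYT_eqI[OF mu(1)] H[OF that(1)] that by metis
  have loc: "svt n lam S" if "S \<in> ?C" for S using lam component_SVT[OF that] by unfold_locales simp_all
  have loc': "svt n mu S" if "S \<in> SSYT n mu" for S using mu that by unfold_locales (simp_all add: SSYT_def)
  show ?thesis
  proof (rule that[folded mu_def])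
    show "bij_betw H ?C (SSYT n mu)"
      unfolding bij_betw_def
    proof (intro conjI inj_onI equalityI subsetI)
      fix S U assume SU: "S \<in> ?C" "U \<in> ?C" "H S = H U"
      interpret U: svt n lam U by (rule loc[OF SU(2)])
      have "h (?R S) = h (?R U)" using H(2) SU by metis
      then have "?R S = ?R U" using h(3) by metis
      then show "S = U" using U.reading_word_inj component_SVT SU(1,2) by simp
    next
      fix S' assume "S' \<in> SSYT n mu"
      then obtain S where "S \<in> ?C" "?R S = k (?Q S')" using preimage by blast
      then show "S' \<in> H ` ?C" using H_eq[of S S'] h(2) \<open>S' \<in> SSYT n mu\<close> by force
    qed (use H in blast)
  next
    fix S assume S: "S \<in> ?C"
    interpret S: svt n lam S by (rule loc[OF S])
    interpret HS: svt n mu "H S" by (rule loc'[OF H(1)[OF S]])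
    show "weight n (H S) = weight n S" by (simp add: S.weight_eq HS.weight_eq H(2)[OF S] h(4))
    fix i assume i: "0 < i" "i < n"
    show "svt_e mu i (H S) = map_option H (svt_e lam i S)"
    proof (cases "svt_e lam i S")
      case None
      then have "word_e i (?Q (H S)) = None" using S.reading_svt_e[OF i] h(6) H(2)[OF S] by simp
      then show ?thesis using None HS.reading_svt_e[OF i] by simp
    next
      case (Some U)
      then have U: "U \<in> ?C" using crystal_closure.e_closed[OF S, of i U] i by (simp add: SVT_crystal_def)
      have "word_e i (?Q (H S)) = Some (h (?R U))"
        using S.reading_svt_e[OF i] h(6) H(2)[OF S] Some by (metis option.simps(9))
      then obtain V where V: "svt_e mu i (H S) = Some V" "?Q V = h (?R U)"
        using HS.reading_svt_e[OF i] by auto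
      then have "H U = V" using H_eq[OF U] HS.SSYT_closed(1)[OF i H(1)[OF S]] by simp
      then show ?thesis using V Some by simp
    qed
    show "svt_f mu i (H S) = map_option H (svt_f lam i S)"
    proof (cases "svt_f lam i S")
      case None
      then have "word_f i (?Q (H S)) = None" using S.reading_svt_f[OF i] h(5) H(2)[OF S] by simp
      then show ?thesis using None HS.reading_svt_f[OF i] by simp
    next
      case (Some U)
      then have U: "U \<in> ?C" using crystal_closure.f_closed[OF S, of i U] i by (simp add: SVT_crystal_def)
      have "word_f i (?Q (H S)) = Some (h (?R U))"
        using S.reading_svt_f[OF i] h(5) H(2)[OF S] Some by (metis option.simps(9))
      then obtain V where V: "svt_f mu i (H S) = Some V" "?Q V = h (?R U)"
        using HS.reading_svt_f[OF i] by auto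
      then have "H U = V" using H_eq[OF U] HS.SSYT_closed(2)[OF i H(1)[OF S]] by simp
      then show ?thesis using V Some by simp
    qed
  qed
qed

text \<open>The isomorphism commutes with all \<open>e_i\<close>, so it sends each Yamanouchi
  element of the component to the only one in \<open>SSYT\<close>; injectivity finishes.\<close>

lemma yamanouchi_unique:
  assumes Y: "T \<in> yamanouchi n lam" and S: "S \<in> yamanouchi n lam" "S \<in> component n lam T"
  shows "S = T"
proof -
  let ?mu = "weight n T"
  obtain H where H: "bij_betw H (component n lam T) (SSYT n ?mu)"
    "\<And>S i. S \<in> component n lam T \<Longrightarrow> 0 < i \<Longrightarrow> i < n \<Longrightarrow>
      svt_e ?mu i (H S) = map_option H (svt_e lam i S)"
    using component_iso[OF Y] by metis
  have "H U = superstandard ?mu" if U: "U \<in> yamanouchi n lam" "U \<in> component n lam T" for U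
  proof -
    have HU: "H U \<in> SSYT n ?mu" using H(1) U(2) by (auto simp: bij_betw_def)
    interpret HU: svt n ?mu "H U"
      using yamanouchi_weight_partition[OF Y] HU by unfold_locales (simp_all add: SSYT_def)
    have "H U \<in> yamanouchi n ?mu"
      using HU.T H(2)[OF U(2)] U(1) by (simp add: yamanouchi_def)
    then show ?thesis using HU.SSYT_yamanouchi[OF HU] by simp
  qed
  then have "H S = H T" using S Y crystal_closure.base by metis
  then show ?thesis using H(1) S(2) crystal_closure.base[of T n "SVT_crystal n lam"]
    by (auto simp: bij_betw_def dest: inj_onD)
qed

end

section \<open>Closedness under the operators and the decomposition\<close>

lemma operators_closed_SVT:
  assumes "is_partition lam"
  shows "operators_closed n (SVT_crystal n lam)"
  unfolding operators_closed_def
proof (intro ballI conjI)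
  fix i S assume h: "i \<in> {1..<n}" "S \<in> crystal_set (SVT_crystal n lam)"
  interpret svt n lam S using assms h by unfold_locales (simp_all add: SVT_crystal_def)
  show "set_option (crystal_e (SVT_crystal n lam) i S) \<subseteq> crystal_set (SVT_crystal n lam)"
    using svt_e_SomeD(1)[of i] h by (auto simp: SVT_crystal_def)
  show "set_option (crystal_f (SVT_crystal n lam) i S) \<subseteq> crystal_set (SVT_crystal n lam)"
    using svt_f_SomeD(1)[of i] h by (auto simp: SVT_crystal_def)
qed

lemma operators_closed_B:
  assumes "is_partition mu"
  shows "operators_closed n (B_crystal n mu)"
  unfolding operators_closed_def
proof (intro ballI conjI)
  fix i S assume h: "i \<in> {1..<n}" "S \<in> crystal_set (B_crystal n mu)"
  then have S: "S \<in> SSYT n mu" by (simp add: B_crystal_def)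
  interpret svt n mu S using assms S by unfold_locales (simp_all add: SSYT_def)
  show "set_option (crystal_e (B_crystal n mu) i S) \<subseteq> crystal_set (B_crystal n mu)"
    using SSYT_closed(1)[of i] S h by (auto simp: SVT_crystal_def B_crystal_def)
  show "set_option (crystal_f (B_crystal n mu) i S) \<subseteq> crystal_set (B_crystal n mu)"
    using SSYT_closed(2)[of i] S h by (auto simp: SVT_crystal_def B_crystal_def)
qed

lemma operators_closed_generated: "operators_closed n (generated_crystal n C x)"
  unfolding operators_closed_def generated_crystal_def
  using crystal_closure.e_closed crystal_closure.f_closed by fastforce

lemma operators_closed_direct_sum:
  "(\<And>k. k \<in> K \<Longrightarrow> operators_closed n (C k)) \<Longrightarrow> operators_closed n (direct_sum K C)"
  unfolding operators_closed_def direct_sum_def by fastforce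

theorem theorem3p9:
  fixes lam :: "nat list" and n :: nat
  assumes "is_partition lam" and "n \<ge> 2"
  shows "(\<forall>T mu. T \<in> yamanouchi n lam \<and> weight n T = mu \<longrightarrow>
            is_partition mu \<and>
            crystal_isomorphic n (generated_crystal n (SVT_crystal n lam) T) (B_crystal n mu)) \<and>
         crystal_isomorphic n (SVT_crystal n lam)
           (direct_sum {(mu, k). is_partition mu \<and> length mu = n \<and> k < yamanouchi_mult n lam mu}
              (\<lambda>(mu, k). B_crystal n mu))"
proof (intro conjI allI impI; (elim conjE)?)
  let ?Y = "yamanouchi n lam"
  have loc: "svt n lam T" if "T \<in> ?Y" for T
    using assms(1) that by unfold_locales (simp_all add: yamanouchi_def)
  fix T mu assume T: "T \<in> ?Y" and mu: "weight n T = mu"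
  interpret T: svt n lam T by (rule loc[OF T])
  show part: "is_partition mu" using T.yamanouchi_weight_partition[OF T] mu by simp
  obtain H where H: "bij_betw H (component n lam T) (SSYT n mu)"
    "\<And>S. S \<in> component n lam T \<Longrightarrow> weight n (H S) = weight n S"
    "\<And>S i. S \<in> component n lam T \<Longrightarrow> 0 < i \<Longrightarrow> i < n \<Longrightarrow>
      svt_e mu i (H S) = map_option H (svt_e lam i S)"
    "\<And>S i. S \<in> component n lam T \<Longrightarrow> 0 < i \<Longrightarrow> i < n \<Longrightarrow>
      svt_f mu i (H S) = map_option H (svt_f lam i S)"
    using T.component_iso[OF T] unfolding mu by blast
  have "crystal_iso n (generated_crystal n (SVT_crystal n lam) T) (B_crystal n mu) H"
    unfolding crystal_iso_def
    using H by (simp add: generated_crystal_def B_crystal_def SVT_crystal_def[of n mu])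
      (simp add: SVT_crystal_def)
  then show "crystal_isomorphic n (generated_crystal n (SVT_crystal n lam) T) (B_crystal n mu)"
    unfolding crystal_isomorphic_def
    by (intro conjI operators_closed_generated operators_closed_B[OF part] exI)
next
  let ?Y = "yamanouchi n lam"
  let ?K = "{(mu, k). is_partition mu \<and> length mu = n \<and> k < yamanouchi_mult n lam mu}"
  have loc: "svt n lam T" if "T \<in> ?Y" for T
    using assms(1) that by unfold_locales (simp_all add: yamanouchi_def)
  define Yw where "Yw mu = {T \<in> ?Y. weight n T = mu}" for mu
  have fin: "finite (Yw mu)" for mu
    by (rule finite_subset[OF _ finite_SVT[of n lam]]) (auto simp: Yw_def yamanouchi_def)
  \<comment> \<open>The numbering \<open>ix\<close> assigns to each Yamanouchi tableau of weight
    \<open>mu\<close> its own copy of \<open>B(mu)\<close>.\<close>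
  have "\<exists>ix. bij_betw ix (Yw mu) {0..<yamanouchi_mult n lam mu}" for mu
    using ex_bij_betw_finite_nat[OF fin[of mu]] by (simp add: yamanouchi_mult_def Yw_def)
  then obtain ix where ix: "bij_betw (ix mu) (Yw mu) {0..<yamanouchi_mult n lam mu}" for mu by metis
  have "\<exists>H. bij_betw H (component n lam T) (SSYT n (weight n T)) \<and>
    (\<forall>S \<in> component n lam T. weight n (H S) = weight n S \<and>
      (\<forall>i. 0 < i \<and> i < n \<longrightarrow> svt_e (weight n T) i (H S) = map_option H (svt_e lam i S) \<and>
        svt_f (weight n T) i (H S) = map_option H (svt_f lam i S)))" if "T \<in> ?Y" for T
    using svt.component_iso[OF loc[OF that] that] by metis
  then obtain H where H: "T \<in> ?Y \<Longrightarrow> bij_betw (H T) (component n lam T) (SSYT n (weight n T)) \<and>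
    (\<forall>S \<in> component n lam T. weight n (H T S) = weight n S \<and>
      (\<forall>i. 0 < i \<and> i < n \<longrightarrow> svt_e (weight n T) i (H T S) = map_option (H T) (svt_e lam i S) \<and>
        svt_f (weight n T) i (H T S) = map_option (H T) (svt_f lam i S)))" for T
    by metis
  have "\<exists>U \<in> ?Y. S \<in> component n lam U" if "S \<in> SVT n lam" for S
    using svt.ex_yamanouchi[OF svt.intro[OF assms(1) that] that] .
  then obtain root where root: "root S \<in> ?Y" "S \<in> component n lam (root S)" if "S \<in> SVT n lam" for S
    by metis
  \<comment> \<open>Since a component contains only one Yamanouchi tableau, \<open>root\<close> is
    constant on it. For the same reason every Yamanouchi tableau is the root of its component, which
    surjectivity needs.\<close>
  have component: "S \<in> SVT n lam \<and> root S = U" if U: "U \<in> ?Y" "S \<in> component n lam U" for S U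
  proof -
    interpret U: svt n lam U by (rule loc[OF U(1)])
    have S: "S \<in> SVT n lam" using U.component_SVT[OF U(2)] by simp
    interpret R: svt n lam "root S" by (rule loc[OF root(1)[OF S]])
    have "root S \<in> component n lam S" by (rule R.component_sym[OF root(2)[OF S]])
    then have "root S \<in> component n lam U" using component_trans U(2) by blast
    then show ?thesis using U.yamanouchi_unique[OF U(1) root(1)[OF S]] S by simp
  qed
  \<comment> \<open>The first entry names the component through its root, the second is the place
    inside the matching copy of \<open>B(mu)\<close>.\<close>
  define G where "G S = ((weight n (root S), ix (weight n (root S)) (root S)), H (root S) S)" for S
  have K: "(weight n U, ix (weight n U) U) \<in> ?K" if U: "U \<in> ?Y" for U
  proof -
    have "ix (weight n U) U < yamanouchi_mult n lam (weight n U)"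
      using ix[of "weight n U"] U by (auto simp: bij_betw_def Yw_def)
    then show ?thesis using svt.yamanouchi_weight_partition[OF loc[OF U] U] by (simp add: weight_def)
  qed
  have "bij_betw G (SVT n lam) (SIGMA k:?K. SSYT n (fst k))"
    unfolding bij_betw_def
  proof (intro conjI inj_onI equalityI subsetI)
    fix S S' assume S: "S \<in> SVT n lam" "S' \<in> SVT n lam" "G S = G S'"
    let ?mu = "weight n (root S)"
    have w: "weight n (root S') = ?mu" "ix ?mu (root S) = ix ?mu (root S')"
        "H (root S) S = H (root S') S'"
      using S(3) by (auto simp: G_def)
    have rS: "root S = root S'"
      by (rule inj_onD[OF bij_betw_imp_inj_on[OF ix[of ?mu]]])
        (use S w(1,2) root(1) in \<open>simp_all add: Yw_def\<close>)
    have "bij_betw (H (root S)) (component n lam (root S)) (SSYT n ?mu)"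
      using H[OF root(1)[OF S(1)]] by simp
    from inj_onD[OF bij_betw_imp_inj_on[OF this], of S S'] show "S = S'"
      using w(3) rS root(2)[OF S(1)] root(2)[OF S(2)] by simp
  next
    fix x assume "x \<in> G ` SVT n lam"
    then obtain S where S: "S \<in> SVT n lam" "x = G S" by blast
    have "H (root S) S \<in> SSYT n (weight n (root S))"
      using H[OF root(1)[OF S(1)]] root(2)[OF S(1)] by (auto simp: bij_betw_def)
    then show "x \<in> (SIGMA k:?K. SSYT n (fst k))" using K[OF root(1)[OF S(1)]] S by (simp add: G_def)
  next
    fix x assume "x \<in> (SIGMA k:?K. SSYT n (fst k))"
    then obtain mu k V where x: "x = ((mu, k), V)" "k < yamanouchi_mult n lam mu" "V \<in> SSYT n mu"
      by auto
    then obtain U where U: "U \<in> ?Y" "weight n U = mu" "ix mu U = k"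
      using ix[of mu] by (force simp: bij_betw_def Yw_def)
    have "V \<in> H U ` component n lam U"
      using bij_betw_imp_surj_on[of "H U" "component n lam U" "SSYT n mu"] H[OF U(1)] U(2) x(3) by simp
    then obtain S where S: "S \<in> component n lam U" "H U S = V" by blast
    then have "S \<in> SVT n lam" "G S = x" using component[OF U(1) S(1)] U x by (auto simp: G_def)
    then show "x \<in> G ` SVT n lam" by blast
  qed
  moreover have "crystal_set (direct_sum ?K (\<lambda>(mu, k). B_crystal n mu)) = (SIGMA k:?K. SSYT n (fst k))"
    by (auto simp: direct_sum_def B_crystal_def)
  moreover have "crystal_wt (direct_sum ?K (\<lambda>(mu, k). B_crystal n mu)) (G S) = weight n S"
    if "S \<in> SVT n lam" for S
    using H[OF root(1)[OF that]] root(2)[OF that]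
    by (simp add: G_def direct_sum_def B_crystal_def SVT_crystal_def)
  moreover have "crystal_e (direct_sum ?K (\<lambda>(mu, k). B_crystal n mu)) i (G S) = map_option G (svt_e lam i S)"
    "crystal_f (direct_sum ?K (\<lambda>(mu, k). B_crystal n mu)) i (G S) = map_option G (svt_f lam i S)"
    if S: "S \<in> SVT n lam" and i: "i \<in> {1..<n}" for S i
  proof -
    \<comment> \<open>The operators stay inside a component, so the index part of \<open>G\<close>
      does not change and only \<open>H (root S)\<close> has to commute with them.\<close>
    have e: "root U = root S" if "svt_e lam i S = Some U" for U
      using component[OF root(1)[OF S]] crystal_closure.e_closed[OF root(2)[OF S] i] that
      by (simp add: SVT_crystal_def)
    have f: "root U = root S" if "svt_f lam i S = Some U" for U
      using component[OF root(1)[OF S]] crystal_closure.f_closed[OF root(2)[OF S] i] that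
      by (simp add: SVT_crystal_def)
    show "crystal_e (direct_sum ?K (\<lambda>(mu, k). B_crystal n mu)) i (G S) = map_option G (svt_e lam i S)"
      using H[OF root(1)[OF S]] root(2)[OF S] e i
      by (cases "svt_e lam i S") (simp_all add: G_def direct_sum_def B_crystal_def SVT_crystal_def)
    show "crystal_f (direct_sum ?K (\<lambda>(mu, k). B_crystal n mu)) i (G S) = map_option G (svt_f lam i S)"
      using H[OF root(1)[OF S]] root(2)[OF S] f i
      by (cases "svt_f lam i S") (simp_all add: G_def direct_sum_def B_crystal_def SVT_crystal_def)
  qed
  ultimately have "crystal_iso n (SVT_crystal n lam) (direct_sum ?K (\<lambda>(mu, k). B_crystal n mu)) G"
    by (simp add: crystal_iso_def SVT_crystal_def)
  moreover have "operators_closed n (direct_sum ?K (\<lambda>(mu, k). B_crystal n mu))"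
    by (rule operators_closed_direct_sum) (use operators_closed_B in auto)
  ultimately show "crystal_isomorphic n (SVT_crystal n lam) (direct_sum ?K (\<lambda>(mu, k). B_crystal n mu))"
    using operators_closed_SVT[OF assms(1)] by (auto simp: crystal_isomorphic_def)
qed

end
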